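(* Let $m$ be a positive integer and, for $Q\ge 1$, let $$\mathfrak{F}_Q^{(m)}=\Big\{\tfrac{a}{q} : 0<a\le q\le Q,\ (a,q)=1,\ (q,m)=1\Big\}.$$ Then the pair correlation function $g_{(m)}$ of the sequence $(\mathfrak{F}_Q^{(m)})_Q$ (as $Q\to\infty$) exists, and for every $\lambda>0$ $$ g_{(m)}(\lambda)=\frac{\varphi(m)}{m}\cdot\frac{C_m}{\lambda^2}\sum_{1\le \Delta\le \frac{2\lambda}{C_m}}\varphi(\Delta)\,\frac{(\Delta,m)}{\varphi\big((\Delta,m)\big)}\,\log\frac{2\lambda}{C_m\Delta}, $$ where $$C_m=\frac{\varphi(m)}{\zeta(2)\,m}\prod_{p\mid m}\Big(1-\frac1{p^2}\Big)^{-1}=\frac{\varphi(m)}{m}\prod_{p\nmid m}\Big(1-\frac1{p^2}\Big)$$ (products over primes $p$).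
   Context: For a finite set $F\subseteq\mathbb{R}$ of cardinality $N(F)$ and an interval $I$, set $$\mathcal{G}_F(I)=\frac{1}{N(F)}\#\Big\{(x,y)\in F^2: y\neq x,\ y-x\in \tfrac{1}{N(F)}I+\mathbb{Z}\Big\}.$$ The pair correlation measure of an increasing family of finite sets $(F_n)$ is $\mathcal{G}(I)=\lim_n\mathcal{G}_{F_n}(I)$ (when the limit exists for every interval $I$). If $G(\lambda):=\mathcal{G}([0,\lambda])=\int_0^\lambda g(x)\,dx$ for all $\lambda>0$, then $g$ is called the pair correlation function of $(F_n)$. Here $\varphi$ is Euler's totient function, $\zeta$ the Riemann zeta function, and $(\Delta,m)$ denotes the gcd. *)

theory Defs
  imports "HOL-Analysis.Analysis" "HOL-Number_Theory.Totient"
begin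

definition pair_corr :: "real set \<Rightarrow> real set \<Rightarrow> real" where
  "pair_corr F I =
     1 / real (card F) *
     real (card {(x, y). x \<in> F \<and> y \<in> F \<and> y \<noteq> x \<and>
       (\<exists>t\<in>I. \<exists>k::int. y - x = 1 / real (card F) * t + of_int k)})"

text \<open>Intervals are bounded: for unbounded \<open>I\<close>, \<open>I / N + \<int>\<close> is all of \<open>\<real>\<close> (for \<open>N > 0\<close>), and
  the normalised count is \<open>N - 1\<close>. Open, closed, half-open and degenerate intervals are all allowed.\<close>

definition pair_correlation_measure :: "(nat \<Rightarrow> real set) \<Rightarrow> (real set \<Rightarrow> real) \<Rightarrow> bool" where
  "pair_correlation_measure F G \<longleftrightarrow>
     incseq F \<and> (\<forall>n. finite (F n)) \<and>
     (\<forall>I. is_interval I \<and> bounded I \<longrightarrow> (\<lambda>n. pair_corr (F n) I) \<longlonglongrightarrow> G I)"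

definition pair_correlation_function :: "(nat \<Rightarrow> real set) \<Rightarrow> (real \<Rightarrow> real) \<Rightarrow> bool" where
  "pair_correlation_function F g \<longleftrightarrow>
     (\<exists>G. pair_correlation_measure F G \<and>
       (\<forall>x>0. g absolutely_integrable_on {0..x} \<and> G {0..x} = integral {0..x} g))"

definition farey_coprime :: "nat \<Rightarrow> nat \<Rightarrow> real set" where
  "farey_coprime m Q =
     {real a / real q | a q. 0 < a \<and> a \<le> q \<and> q \<le> Q \<and> coprime a q \<and> coprime q m}"

text \<open>The Riemann zeta function on its half-line of convergence \<open>s > 1\<close>.\<close>

definition zeta :: "real \<Rightarrow> real" where
  "zeta s = (\<Sum>n. 1 / real (Suc n) powr s)"

definition C :: "nat \<Rightarrow> real" where
  "C m = real (totient m) / (zeta 2 * real m) *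
     (\<Prod>p | prime p \<and> p dvd m. inverse (1 - 1 / (real p)\<^sup>2))"

end

theory Submission
  imports Defs "HOL-Probability.Weak_Convergence" "HOL-Real_Asymp.Real_Asymp"
begin

text \<open>
  Two fractions \<open>a / q < b / s\<close> with denominators at most \<open>n\<close> have distance \<open>D / (q s)\<close>, where
  \<open>D = b q - a s\<close>, and there are about \<open>C m n\<^sup>2 / 2\<close> fractions. So only boundedly many determinants \<open>D\<close>
  contribute at the scale of the mean spacing, and it suffices to count, for each fixed \<open>D\<close>, the pairs with
  \<open>q s > D n\<^sup>2 / c\<close>. Suppose first that only \<open>a / q\<close> is reduced. For fixed \<open>q\<close>, summing over \<open>s\<close> the number
  of units \<open>a\<close> modulo \<open>q\<close> with \<open>a s \<equiv> -D\<close> is a sieve problem with main term \<open>\<phi>(m)/m \<cdot> \<phi>(q)/q\<close> times the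
  length of the \<open>s\<close>-interval and error \<open>O(2\<^bsup>\<omega>(q)\<^esup>) = O(\<surd>q)\<close>; no exponential sums are needed. The mean value
  of \<open>\<phi>(q)/q\<close> over \<open>q\<close> coprime to \<open>m\<close> is \<open>C m\<close>, so the sum over \<open>q\<close> tends to an integral, the area of a
  piece of the unit square cut off by a hyperbola. Sorting these pairs by \<open>gcd b s\<close> and inducting on \<open>D\<close>
  isolates the pairs in which \<open>b / s\<close> is reduced too. Differentiating the resulting distribution function
  gives the formula.
\<close>

section \<open>Sieving an interval by finitely many primes\<close>

definition nats_between :: "real \<Rightarrow> real \<Rightarrow> nat set" where
  "nats_between u v = {n. u < real n \<and> real n \<le> v}"

lemma nats_between_eq_floor:
  assumes "0 \<le> u"
  shows "nats_between u v = {nat \<lfloor>u\<rfloor><..nat \<lfloor>v\<rfloor>}"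
proof -
  have "u < real n \<longleftrightarrow> nat \<lfloor>u\<rfloor> < n" for n
    using assms by (simp add: nat_less_iff floor_less_iff)
  moreover have "real n \<le> v \<longleftrightarrow> n \<le> nat \<lfloor>v\<rfloor>" if "u < real n" for n
    using assms that by (cases "0 \<le> v") (auto simp: le_nat_iff le_floor_iff)
  ultimately show ?thesis by (auto simp: nats_between_def)
qed

lemma finite_nats_between [simp]: "finite (nats_between u v)"
  by (rule finite_subset[of _ "{..nat \<lfloor>v\<rfloor>}"]) (auto simp: nats_between_def le_nat_floor)

lemma nats_between_0_of_nat: "nats_between 0 (real n) = {1..n}"
  by (auto simp: nats_between_def)

lemma card_nats_between:
  assumes "0 \<le> u" "u \<le> v"
  shows "\<bar>real (card (nats_between u v)) - (v - u)\<bar> \<le> 1"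
proof -
  have "nat \<lfloor>u\<rfloor> \<le> nat \<lfloor>v\<rfloor>" using assms by (intro nat_mono floor_mono)
  hence "real (card (nats_between u v)) = of_int \<lfloor>v\<rfloor> - of_int \<lfloor>u\<rfloor>"
    using assms by (simp add: nats_between_eq_floor of_nat_diff)
  thus ?thesis by linarith
qed

lemma mult_in_nats_between_iff:
  assumes "d > 0"
  shows "d * k \<in> nats_between u v \<longleftrightarrow> k \<in> nats_between (u / real d) (v / real d)"
  using assms by (simp add: nats_between_def field_simps)

lemma sum_multiples_nats_between:
  assumes "d > 0"
  shows "(\<Sum>n | n \<in> nats_between u v \<and> d dvd n. f n)
       = (\<Sum>k\<in>nats_between (u / real d) (v / real d). f (d * k))"
proof -
  have "{n. n \<in> nats_between u v \<and> d dvd n} = (*) d ` nats_between (u / real d) (v / real d)"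
    using mult_in_nats_between_iff[OF assms] by (auto elim!: dvdE)
  moreover have "inj_on ((*) d) A" for A using assms by (simp add: inj_on_def)
  ultimately show ?thesis by (simp add: sum.reindex)
qed

definition sieve_weight :: "(nat \<Rightarrow> real) \<Rightarrow> nat set \<Rightarrow> nat \<Rightarrow> real" where
  "sieve_weight c S n = (\<Prod>p\<in>S. if p dvd n then 1 - c p else 1)"

lemma sieve_weight_insert:
  assumes "finite S" "p \<notin> S"
  shows "sieve_weight c (insert p S) n
       = sieve_weight c S n - c p * (if p dvd n then sieve_weight c S n else 0)"
  using assms by (simp add: sieve_weight_def algebra_simps)

lemma prime_dvd_distinct_prime_mult_iff:
  fixes p r n :: nat
  assumes "prime p" "prime r" "r \<noteq> p"
  shows "r dvd p * n \<longleftrightarrow> r dvd n"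
  using assms by (metis prime_dvd_mult_iff primes_dvd_imp_eq)

lemma sieve_weight_mult_prime:
  assumes "prime p" "\<And>r. r \<in> S \<Longrightarrow> prime r" "p \<notin> S"
  shows "sieve_weight c S (p * n) = sieve_weight c S n"
  unfolding sieve_weight_def
  using assms by (intro prod.cong refl) (metis prime_dvd_distinct_prime_mult_iff)

lemma sum_sieve_weight_insert:
  assumes "finite S" "\<And>r. r \<in> insert p S \<Longrightarrow> prime r" "p \<notin> S"
  shows "sum (sieve_weight c (insert p S)) (nats_between u v)
       = sum (sieve_weight c S) (nats_between u v)
         - c p * sum (sieve_weight c S) (nats_between (u / real p) (v / real p))"
proof -
  have prime_p: "prime p" "p > 0" using assms(2)[of p] by (auto simp: prime_gt_0_nat)
  have "sum (sieve_weight c (insert p S)) (nats_between u v)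
      = sum (sieve_weight c S) (nats_between u v)
        - c p * (\<Sum>n | n \<in> nats_between u v \<and> p dvd n. sieve_weight c S n)"
    using assms
    by (simp add: sieve_weight_insert sum_subtractf sum.inter_filter flip: sum_distrib_left)
  also have "(\<Sum>n | n \<in> nats_between u v \<and> p dvd n. sieve_weight c S n)
      = sum (sieve_weight c S) (nats_between (u / real p) (v / real p))"
    using prime_p assms by (simp add: sum_multiples_nats_between sieve_weight_mult_prime)
  finally show ?thesis .
qed

lemma sum_sieve_weight:
  assumes "finite S" "\<And>p. p \<in> S \<Longrightarrow> prime p" "\<And>p. p \<in> S \<Longrightarrow> 0 \<le> c p \<and> c p \<le> 1"
    and "0 \<le> u" "u \<le> v"
  shows "\<bar>sum (sieve_weight c S) (nats_between u v) - (v - u) * (\<Prod>p\<in>S. 1 - c p / real p)\<bar>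
           \<le> 2 ^ card S"
  using assms
proof (induction S arbitrary: u v rule: finite_induct)
  case empty
  thus ?case using card_nats_between by (simp add: sieve_weight_def)
next
  case (insert p S)
  define E where "E u v = sum (sieve_weight c S) (nats_between u v)
      - (v - u) * (\<Prod>p\<in>S. 1 - c p / real p)" for u v
  have c_bounds: "0 \<le> c p" "c p \<le> 1" using insert.prems(2)[of p] by auto
  have E_bound: "\<bar>E x y\<bar> \<le> 2 ^ card S" if "0 \<le> x" "x \<le> y" for x y
    using insert.IH insert.prems(1,2) that by (simp add: E_def)
  have insert_sum: "sum (sieve_weight c (insert p S)) (nats_between u v)
      = sum (sieve_weight c S) (nats_between u v)
        - c p * sum (sieve_weight c S) (nats_between (u / real p) (v / real p))"
    using insert.hyps insert.prems(1) by (intro sum_sieve_weight_insert) auto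
  have "sum (sieve_weight c (insert p S)) (nats_between u v)
        - (v - u) * (\<Prod>p\<in>insert p S. 1 - c p / real p)
      = E u v - c p * E (u / real p) (v / real p)"
    unfolding insert_sum prod.insert[OF insert.hyps] E_def by argo
  also have "\<bar>\<dots>\<bar> \<le> \<bar>E u v\<bar> + c p * \<bar>E (u / real p) (v / real p)\<bar>"
    using c_bounds by (intro order_trans[OF abs_triangle_ineq4]) (simp add: abs_mult)
  also have "\<dots> \<le> 2 ^ card S + 1 * 2 ^ card S"
    using insert.prems(3,4) c_bounds
    by (intro add_mono mult_mono E_bound) (simp_all add: divide_right_mono)
  finally show ?case using insert.hyps by simp
qed

lemma coprime_iff_prime_factors_not_dvd:
  fixes n r :: nat
  assumes "r > 0"
  shows "coprime n r \<longleftrightarrow> (\<forall>p\<in>prime_factors r. \<not> p dvd n)"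
proof
  assume "coprime n r"
  thus "\<forall>p\<in>prime_factors r. \<not> p dvd n"
    by (metis coprime_common_divisor in_prime_factors_iff not_prime_unit)
next
  assume "\<forall>p\<in>prime_factors r. \<not> p dvd n"
  hence "\<not> (p dvd n \<and> p dvd r)" if "prime p" for p
    using assms that by (auto simp: in_prime_factors_iff)
  thus "coprime n r"
    by (metis coprime_iff_gcd_eq_1 gcd_greatest_iff prime_factor_nat)
qed

definition totient_density :: "nat \<Rightarrow> real" where
  "totient_density n = real (totient n) / real n"

lemma totient_density_eq_prod: "n > 0 \<Longrightarrow> totient_density n = (\<Prod>p\<in>prime_factors n. 1 - 1 / real p)"
  by (simp add: totient_density_def totient_formula2)

lemma totient_density_mult_coprime:
  "coprime a b \<Longrightarrow> totient_density (a * b) = totient_density a * totient_density b"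
  by (simp add: totient_density_def totient_mult_coprime)

lemma card_coprime_nats_between:
  assumes "r > 0" "0 \<le> u" "u \<le> v"
  shows "\<bar>real (card {n\<in>nats_between u v. coprime n r}) - (v - u) * totient_density r\<bar>
           \<le> 2 ^ card (prime_factors r)"
proof -
  have "sieve_weight (\<lambda>_. 1) (prime_factors r) n = of_bool (coprime n r)" for n
    using assms(1) by (auto simp: sieve_weight_def coprime_iff_prime_factors_not_dvd)
  hence "sum (sieve_weight (\<lambda>_. 1) (prime_factors r)) (nats_between u v)
      = real (card {n\<in>nats_between u v. coprime n r})"
    by (simp add: sum.inter_filter[symmetric] of_bool_def)
  moreover have "prime p" if "p \<in> prime_factors r" for p
    using that by (rule in_prime_factors_imp_prime)
  ultimately show ?thesis
    using sum_sieve_weight[of "prime_factors r" "\<lambda>_. 1" u v] assms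
    by (simp add: totient_density_eq_prod)
qed

lemma four_power_card_primes_le:
  fixes S :: "nat set"
  assumes "finite S" "\<And>p. p \<in> S \<Longrightarrow> prime p"
  shows "4 ^ card S \<le> 3 * \<Prod>S"
proof -
  define T where "T = S - {2, 3}"
  have T_decomp: "finite T" "S = T \<union> (S \<inter> {2, 3})" "T \<inter> (S \<inter> {2, 3}) = {}"
    using assms(1) by (auto simp: T_def)
  have "(\<Prod>p\<in>T. 4) \<le> \<Prod>T"
  proof (intro prod_mono conjI)
    fix p assume "p \<in> T"
    hence "prime p" "p \<noteq> 2" "p \<noteq> 3" using assms by (auto simp: T_def)
    thus "4 \<le> p" using prime_ge_2_nat[of p] by linarith
  qed auto
  moreover have "(\<Prod>p\<in>S \<inter> {2, 3}. 4) \<le> 3 * \<Prod>(S \<inter> {2, 3})"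
  proof -
    have "S \<inter> {2, 3} \<in> {{}, {2}, {3}, {2, 3}}" by auto
    thus ?thesis by auto
  qed
  ultimately have "(\<Prod>p\<in>T. 4) * (\<Prod>p\<in>S \<inter> {2, 3}. 4) \<le> \<Prod>T * (3 * \<Prod>(S \<inter> {2, 3}))"
    by (rule mult_le_mono)
  moreover have "(\<Prod>p\<in>S. f p) = (\<Prod>p\<in>T. f p) * (\<Prod>p\<in>S \<inter> {2, 3}. f p)" for f :: "nat \<Rightarrow> nat"
    using T_decomp by (metis finite_Int prod.union_disjoint assms(1))
  ultimately show ?thesis by (metis prod_constant mult.left_commute)
qed

lemma two_power_card_prime_factors_le:
  assumes "q > 0"
  shows "2 ^ card (prime_factors q) \<le> 2 * sqrt (real q)"
proof -
  have "\<Prod>(prime_factors q) dvd (\<Prod>p\<in>prime_factors q. p ^ multiplicity p q)"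
    by (intro prod_dvd_prod) (auto simp: prime_factors_multiplicity)
  hence "\<Prod>(prime_factors q) \<le> q"
    using prime_factorization_nat[of q] assms by (simp add: dvd_imp_le)
  hence "4 ^ card (prime_factors q) \<le> 3 * q"
    using four_power_card_primes_le[of "prime_factors q"] by fastforce
  hence "real (4 ^ card (prime_factors q)) \<le> real (3 * q)" by (rule of_nat_mono)
  hence "(2 ^ card (prime_factors q))\<^sup>2 \<le> (2 * sqrt (real q))\<^sup>2"
    by (simp add: power2_eq_square power_mult_distrib[symmetric])
  thus ?thesis by (rule power2_le_imp_le) simp
qed

section \<open>A linear congruence in units\<close>

lemma exists_coprime_cong:
  fixes u n q :: nat
  assumes "coprime u n" "n dvd q" "q > 0"
  shows "\<exists>v. coprime v q \<and> [v = u] (mod n)"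
proof -
  define t where "t = \<Prod>{p\<in>prime_factors q. \<not> p dvd u}"
  have "\<not> p dvd u + n * t" if p_factor: "p \<in> prime_factors q" for p
  proof (cases "p dvd u")
    case True
    have prime_p: "prime p" using p_factor by auto
    have "\<not> p dvd n" using True assms(1) prime_p
      by (metis coprime_common_divisor not_prime_unit)
    moreover have "\<not> p dvd t"
    proof
      assume "p dvd t"
      then obtain r where "r \<in> prime_factors q" "\<not> r dvd u" "p dvd r"
        unfolding t_def using prime_p by (auto simp: prime_dvd_prod_iff)
      thus False using True prime_p by (metis in_prime_factors_iff primes_dvd_imp_eq)
    qed
    ultimately show ?thesis using True prime_p
      by (metis dvd_add_right_iff prime_dvd_mult_iff)
  next
    case False
    have "p dvd t" unfolding t_def using p_factor False by (intro dvd_prodI) auto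
    thus ?thesis using False by (metis dvd_add_left_iff dvd_mult)
  qed
  hence "coprime (u + n * t) q" using assms by (simp add: coprime_iff_prime_factors_not_dvd)
  moreover have "[u + n * t = u] (mod n)" by (simp add: cong_def)
  ultimately show ?thesis by blast
qed

lemma exists_coprime_multiplier:
  fixes s s' q :: nat
  assumes "gcd s q = gcd s' q" "q > 0"
  shows "\<exists>v. coprime v q \<and> [v * s = s'] (mod q)"
proof -
  define h where "h = gcd s q"
  have "h > 0" using assms by (simp add: h_def)
  obtain s1 n where s_decomp: "s = s1 * h" "q = n * h" "coprime s1 n"
    using gcd_coprime_exists[of s q] \<open>h > 0\<close> unfolding h_def by auto
  obtain s1' n' where s'_decomp: "s' = s1' * h" "q = n' * h" "coprime s1' n'"
    using gcd_coprime_exists[of s' q] \<open>h > 0\<close> assms(1) unfolding h_def by auto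
  have "n' = n" using s_decomp(2) s'_decomp(2) \<open>h > 0\<close> by simp
  obtain x where inverse: "[s1 * x = Suc 0] (mod n)"
    using cong_solve_coprime_nat[OF s_decomp(3)] by auto
  hence "coprime (s1' * x) n"
    using s'_decomp(3) \<open>n' = n\<close>
    by (metis coprime_iff_invertible_nat coprime_mult_left_iff mult.commute)
  then obtain v where multiplier: "coprime v q" "[v = s1' * x] (mod n)"
    using exists_coprime_cong assms(2) s_decomp(2) by (metis dvd_triv_left)
  have "[v * s1 = s1' * x * s1] (mod n)" using multiplier(2) by (rule cong_scalar_right)
  also have "s1' * x * s1 = s1' * (s1 * x)" by simp
  also have "[\<dots> = s1' * Suc 0] (mod n)" using inverse by (rule cong_scalar_left)
  finally have "[v * s = s'] (mod q)"
    unfolding s_decomp(1,2) s'_decomp(1) cong_def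
    by (simp add: mult.assoc[symmetric] mod_mult_mult2)
  with multiplier show ?thesis by blast
qed

definition unit_solutions :: "nat \<Rightarrow> nat \<Rightarrow> nat \<Rightarrow> nat set" where
  "unit_solutions q D s = {a\<in>totatives q. q dvd a * s + D}"

lemma finite_unit_solutions [simp]: "finite (unit_solutions q D s)"
  by (simp add: unit_solutions_def)

lemma inj_on_affine_mod:
  fixes a D q :: nat
  assumes "coprime a q"
  shows "inj_on (\<lambda>s. (a * s + D) mod q) {0<..q}"
proof (rule inj_onI)
  fix s t assume range: "s \<in> {0<..q}" "t \<in> {0<..q}" and "(a * s + D) mod q = (a * t + D) mod q"
  hence "[s = t] (mod q)"
    using assms by (simp add: cong_def[symmetric] cong_add_rcancel_nat cong_mult_lcancel_nat)
  with range show "s = t"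
    by (cases "s = q"; cases "t = q") (auto simp: cong_def)
qed

lemma mult_mod_in_totatives:
  assumes "coprime a q" "coprime v q" "q > 1"
  shows "a * v mod q \<in> totatives q"
proof -
  have "coprime (a * v mod q) q" using assms by simp
  moreover from this have "a * v mod q \<noteq> 0"
    using assms(3) by (metis coprime_0_left_iff nat_dvd_1_iff_1 nat_neq_iff)
  ultimately show ?thesis using assms(3) by (simp add: in_totatives_iff less_imp_le)
qed

text \<open>If \<open>v s \<equiv> s'\<close> modulo \<open>q\<close> with \<open>v\<close> a unit, then \<open>a \<mapsto> a v\<close> carries solutions for \<open>s'\<close> to
  solutions for \<open>s\<close>.\<close>

lemma card_unit_solutions_le:
  assumes "gcd s q = gcd s' q" "q > 0"
  shows "card (unit_solutions q D s') \<le> card (unit_solutions q D s)"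
proof (cases "q = 1")
  case True
  thus ?thesis by (simp add: unit_solutions_def)
next
  case False
  hence "q > 1" using assms by simp
  obtain v where multiplier: "coprime v q" "[v * s = s'] (mod q)"
    using exists_coprime_multiplier[OF assms] by blast
  show ?thesis
  proof (rule card_inj_on_le[of "\<lambda>a. a * v mod q"])
    show "inj_on (\<lambda>a. a * v mod q) (unit_solutions q D s')"
    proof (rule inj_on_subset)
      show "inj_on (\<lambda>a. a * v mod q) {0<..q}"
        using inj_on_affine_mod[OF multiplier(1), of 0] by (simp add: mult.commute)
    qed (auto simp: unit_solutions_def totatives_def)
    show "(\<lambda>a. a * v mod q) ` unit_solutions q D s' \<subseteq> unit_solutions q D s"
    proof safe
      fix a assume solution: "a \<in> unit_solutions q D s'"
      have "[a * v mod q * s + D = a * v * s + D] (mod q)"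
        by (intro cong_add cong_mult cong_mod_leftI) auto
      also have "a * v * s + D = a * (v * s) + D" by simp
      also have "[\<dots> = a * s' + D] (mod q)" using multiplier by (intro cong_add cong_mult) auto
      finally have "q dvd a * v mod q * s + D"
        using solution by (simp add: unit_solutions_def cong_dvd_iff)
      moreover have "a * v mod q \<in> totatives q"
        using solution multiplier(1) \<open>q > 1\<close>
        by (intro mult_mod_in_totatives) (auto simp: unit_solutions_def totatives_def)
      ultimately show "a * v mod q \<in> unit_solutions q D s" by (simp add: unit_solutions_def)
    qed
  qed simp
qed

lemma gcd_eq_if_in_unit_solutions:
  assumes "a \<in> unit_solutions q D s"
  shows "gcd s q = gcd D q"
proof -
  have solution: "coprime a q" "q dvd a * s + D"
    using assms by (auto simp: unit_solutions_def totatives_def)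
  have "gcd s q = gcd (a * s) q"
    using solution(1) by (simp add: gcd_mult_left_left_cancel coprime_commute)
  also have "\<dots> = gcd D q"
    using solution(2) by (intro dvd_antisym gcd_greatest gcd_dvd2)
      (meson dvd_add_right_iff dvd_add_left_iff dvd_trans gcd_dvd1 gcd_dvd2)+
  finally show ?thesis .
qed

lemma card_affine_dvd:
  fixes a D q :: nat
  assumes "coprime a q" "q > 0"
  shows "card {s\<in>{0<..q}. q dvd a * s + D} = 1"
proof -
  let ?f = "\<lambda>s. (a * s + D) mod q"
  have inj: "inj_on ?f {0<..q}" by (rule inj_on_affine_mod[OF assms(1)])
  have "?f ` {0<..q} = {..<q}"
    using assms(2) by (intro card_subset_eq) (auto simp: card_image[OF inj])
  then obtain s where root: "s \<in> {0<..q}" "?f s = 0"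
    using assms(2) by (metis (no_types, lifting) imageE lessThan_iff)
  have "{s\<in>{0<..q}. ?f s = 0} = {s}"
  proof (intro equalityI subsetI)
    fix t assume "t \<in> {s\<in>{0<..q}. ?f s = 0}"
    thus "t \<in> {s}" using inj_onD[OF inj, of t s] root by simp
  qed (use root in simp)
  thus ?thesis by (simp add: dvd_eq_mod_eq_0)
qed

lemma sum_card_unit_solutions:
  assumes "q > 0"
  shows "(\<Sum>s\<in>{0<..q}. card (unit_solutions q D s)) = totient q"
proof -
  have "(\<Sum>s\<in>{0<..q}. card (unit_solutions q D s)) = card (SIGMA s:{0<..q}. unit_solutions q D s)"
    by (simp add: card_SigmaI)
  also have "\<dots> = card (SIGMA a:totatives q. {s\<in>{0<..q}. q dvd a * s + D})"
    by (rule bij_betw_same_card[of prod.swap])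
       (auto simp: bij_betw_def inj_on_def unit_solutions_def image_iff)
  also have "\<dots> = (\<Sum>a\<in>totatives q. 1)"
    using assms card_affine_dvd[of _ q D]
    by (subst card_SigmaI) (auto simp: totatives_def intro!: sum.cong)
  finally show ?thesis by (simp add: totient_def)
qed

lemma card_unit_solutions:
  assumes "q > 0" "gcd s q = gcd D q"
  shows "card (unit_solutions q D s) * totient (q div gcd D q) = totient q"
proof -
  define R where "R = {t\<in>{0<..q}. gcd t q = gcd D q}"
  have "card (unit_solutions q D t) = card (unit_solutions q D s)" if "t \<in> R" for t
    using card_unit_solutions_le[of s q t D] card_unit_solutions_le[of t q s D] assms that
    by (simp add: R_def)
  moreover have "card R = totient (q div gcd D q)"
    using card_gcd_eq_totient[of q "gcd D q"] assms by (simp add: R_def)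
  ultimately have "card (unit_solutions q D s) * totient (q div gcd D q)
      = (\<Sum>t\<in>R. card (unit_solutions q D t))" by simp
  also have "\<dots> = (\<Sum>t\<in>{0<..q}. card (unit_solutions q D t))"
    using gcd_eq_if_in_unit_solutions by (intro sum.mono_neutral_left) (auto simp: R_def)
  also have "\<dots> = totient q" by (rule sum_card_unit_solutions[OF assms(1)])
  finally show ?thesis .
qed

lemma totient_density_mult_le:
  assumes "h > 0" "n > 0"
  shows "totient_density (h * n) \<le> totient_density n"
proof -
  let ?f = "\<lambda>p. 1 - 1 / real p"
  have factor_bounds: "0 \<le> ?f p" "?f p \<le> 1" if "p \<in> prime_factors (h * n)" for p
    using prime_gt_0_nat[OF in_prime_factors_imp_prime[OF that]] by auto
  have factors_subset: "prime_factors n \<subseteq> prime_factors (h * n)"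
    using assms by (auto simp: prime_factors_product)
  hence "(\<Prod>p\<in>prime_factors (h * n). ?f p)
      = (\<Prod>p\<in>prime_factors (h * n) - prime_factors n. ?f p) * (\<Prod>p\<in>prime_factors n. ?f p)"
    by (intro prod.subset_diff) auto
  also have "\<dots> \<le> 1 * (\<Prod>p\<in>prime_factors n. ?f p)"
    using factor_bounds factors_subset by (intro mult_right_mono prod_le_1 prod_nonneg) auto
  finally show ?thesis using assms by (simp add: totient_density_eq_prod)
qed

lemma totient_mult_le_mult_totient:
  assumes "h > 0" "n > 0"
  shows "totient (h * n) \<le> h * totient n"
  using totient_density_mult_le[OF assms] assms
  by (simp add: totient_density_def field_simps flip: of_nat_mult)

lemma card_coprime_gcd_eq_nats_between:
  assumes "h > 0" "coprime h m"
  shows "card {s\<in>nats_between u v. coprime s m \<and> gcd s (h * n) = h}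
       = card {k\<in>nats_between (u / real h) (v / real h). coprime k (m * n)}"
proof -
  have gcd_eq_iff: "gcd (h * k) (h * n) = h \<longleftrightarrow> coprime k n" for k
    using assms(1) by (simp add: gcd_mult_distrib_nat[symmetric] coprime_iff_gcd_eq_1)
  have "h * k \<in> {s\<in>nats_between u v. coprime s m \<and> gcd s (h * n) = h}
      \<longleftrightarrow> k \<in> {k\<in>nats_between (u / real h) (v / real h). coprime k (m * n)}" for k
    using assms gcd_eq_iff by (simp add: mult_in_nats_between_iff)
  moreover have "h dvd s" if "gcd s (h * n) = h" for s
    using that by (metis gcd_dvd1)
  ultimately have "{s\<in>nats_between u v. coprime s m \<and> gcd s (h * n) = h}
      = (*) h ` {k\<in>nats_between (u / real h) (v / real h). coprime k (m * n)}"
    by (blast elim: dvdE)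
  moreover have "inj_on ((*) h) A" for A using assms by (simp add: inj_on_def)
  ultimately show ?thesis by (simp add: card_image)
qed

lemma sum_card_unit_solutions_eq:
  fixes q D m :: nat
  assumes "q > 0" "coprime q m"
  defines "h \<equiv> gcd D q"
  shows "(\<Sum>s | s \<in> nats_between u v \<and> coprime s m. real (card (unit_solutions q D s)))
       = real (totient q) / real (totient (q div h))
         * real (card {k\<in>nats_between (u / real h) (v / real h). coprime k (m * (q div h))})"
proof -
  have gcd_props: "h > 0" "h * (q div h) = q" "coprime h m"
    using assms coprime_divisors[of "gcd D q" q m m] by (simp_all add: h_def)
  define A where "A = {s\<in>nats_between u v. coprime s m \<and> gcd s q = h}"
  have "(\<Sum>s | s \<in> nats_between u v \<and> coprime s m. real (card (unit_solutions q D s)))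
      = (\<Sum>s\<in>A. real (card (unit_solutions q D s)))"
    using gcd_eq_if_in_unit_solutions[of _ q D]
    by (intro sum.mono_neutral_right) (auto simp: A_def h_def)
  also have "\<dots> = (\<Sum>s\<in>A. real (totient q) / real (totient (q div h)))"
  proof (intro sum.cong refl)
    fix s assume "s \<in> A"
    hence "card (unit_solutions q D s) * totient (q div h) = totient q"
      using card_unit_solutions[of q s D] assms(1) by (simp add: A_def h_def)
    moreover have "q div h > 0" using gcd_props(2) assms(1) by (cases "q div h") auto
    ultimately show "real (card (unit_solutions q D s)) = real (totient q) / real (totient (q div h))"
      by (simp add: field_simps flip: of_nat_mult)
  qed
  also have "\<dots> = real (totient q) / real (totient (q div h)) * real (card A)" by simp
  also have "card A = card {k\<in>nats_between (u / real h) (v / real h). coprime k (m * (q div h))}"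
    using card_coprime_gcd_eq_nats_between[OF gcd_props(1,3), of u v "q div h"] gcd_props(2)
    by (simp add: A_def)
  finally show ?thesis .
qed

lemma card_prime_factors_mult_le:
  fixes a b :: nat
  assumes "a > 0" "b > 0"
  shows "card (prime_factors (a * b)) \<le> card (prime_factors a) + card (prime_factors b)"
  using assms card_Un_le[of "prime_factors a" "prime_factors b"]
  by (simp add: prime_factors_product)

text \<open>The main term does not depend on \<open>D\<close>: the number of solutions per \<open>s\<close>, which is
  \<open>totient q / totient (q div gcd D q)\<close>, cancels against the density of the \<open>s\<close> with
  \<open>gcd s q = gcd D q\<close>.\<close>

lemma sum_card_unit_solutions_approx:
  assumes "q > 0" "D > 0" "m > 0" "coprime q m" "0 \<le> u" "u \<le> v"
  shows "\<bar>(\<Sum>s | s \<in> nats_between u v \<and> coprime s m. real (card (unit_solutions q D s)))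
            - (v - u) * (totient_density m * totient_density q)\<bar>
         \<le> real D * 2 ^ card (prime_factors m) * 2 ^ card (prime_factors q)"
proof -
  define h n where "h = gcd D q" and "n = q div h"
  define \<nu> where "\<nu> = real (totient q) / real (totient n)"
  have gcd_props: "h > 0" "h \<le> D" "q = h * n"
    using assms by (auto simp: h_def n_def intro: dvd_imp_le)
  have cofactor_props: "n > 0" "coprime m n"
    using gcd_props assms by (auto intro: Nat.gr0I simp: coprime_commute)
  have \<nu>_density: "\<nu> * totient_density n = real h * totient_density q"
    using gcd_props cofactor_props by (simp add: \<nu>_def totient_density_def)
  have \<nu>_bounds: "0 \<le> \<nu>" "\<nu> \<le> real h"
    using totient_mult_le_mult_totient[OF gcd_props(1) cofactor_props(1)] cofactor_props(1)
    by (simp_all add: \<nu>_def gcd_props(3) pos_divide_le_eq flip: of_nat_mult)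
  have "\<nu> * ((v / real h - u / real h) * totient_density (m * n))
      = (v - u) / real h * totient_density m * (\<nu> * totient_density n)"
    by (simp add: totient_density_mult_coprime[OF cofactor_props(2)] flip: diff_divide_distrib)
  also have "\<dots> = (v - u) * (totient_density m * totient_density q)"
    using gcd_props(1) by (simp add: \<nu>_density)
  finally have main_term: "(v - u) * (totient_density m * totient_density q)
      = \<nu> * ((v / real h - u / real h) * totient_density (m * n))" ..
  have "\<bar>(\<Sum>s | s \<in> nats_between u v \<and> coprime s m. real (card (unit_solutions q D s)))
            - (v - u) * (totient_density m * totient_density q)\<bar>
      = \<nu> * \<bar>real (card {k\<in>nats_between (u / real h) (v / real h). coprime k (m * n)})
            - (v / real h - u / real h) * totient_density (m * n)\<bar>"
    unfolding main_term sum_card_unit_solutions_eq[OF assms(1,4)]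
      h_def[symmetric] n_def[symmetric] \<nu>_def[symmetric] right_diff_distrib[symmetric]
    using \<nu>_bounds(1) by (simp add: abs_mult)
  also have "\<dots> \<le> real D * 2 ^ card (prime_factors (m * n))"
    using \<nu>_bounds(2) gcd_props assms cofactor_props
    by (intro mult_mono card_coprime_nats_between) (auto simp: divide_right_mono)
  also have "\<dots> \<le> real D * 2 ^ (card (prime_factors m) + card (prime_factors q))"
  proof (intro mult_left_mono power_increasing)
    have "card (prime_factors n) \<le> card (prime_factors q)"
      using assms(1) gcd_props(3) by (intro card_mono dvd_prime_factors) auto
    thus "card (prime_factors (m * n)) \<le> card (prime_factors m) + card (prime_factors q)"
      using card_prime_factors_mult_le[OF assms(3) cofactor_props(1)] by linarith
  qed auto
  finally show ?thesis by (simp add: power_add mult.assoc)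
qed

section \<open>The mean value of the totient ratio\<close>

lemma tendsto_divide_of_approx:
  fixes N M g E :: "'a \<Rightarrow> real"
  assumes "\<forall>\<^sub>F n in F. g n > 0" "\<forall>\<^sub>F n in F. \<bar>N n - M n * g n\<bar> \<le> E n"
    and "((\<lambda>n. E n / g n) \<longlongrightarrow> 0) F" "(M \<longlongrightarrow> L) F"
  shows "((\<lambda>n. N n / g n) \<longlongrightarrow> L) F"
proof -
  have "((\<lambda>n. N n / g n - M n) \<longlongrightarrow> 0) F"
  proof (rule Lim_null_comparison)
    show "\<forall>\<^sub>F n in F. norm (N n / g n - M n) \<le> E n / g n"
      using assms(1,2)
    proof eventually_elim
      case (elim n)
      have "N n / g n - M n = (N n - M n * g n) / g n"
        using elim(1) by (simp add: diff_divide_distrib)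
      thus ?case using elim by (simp add: abs_divide divide_right_mono)
    qed
  qed (rule assms(3))
  from tendsto_add[OF this assms(4)] show ?thesis by simp
qed

lemma sum_inverse_squares_tail:
  assumes "P \<ge> 1"
  shows "(\<Sum>k\<in>{P<..n}. 1 / (real k)\<^sup>2) \<le> 1 / real P"
proof -
  have "(\<Sum>k\<in>{P<..n}. 1 / (real k)\<^sup>2) \<le> 1 / real P - 1 / real n" if "n \<ge> P"
    using that
  proof (induction n rule: dec_induct)
    case (step n)
    have n_pos: "real n > 0" using step assms by simp
    have "{P<..Suc n} = insert (Suc n) {P<..n}" using step by auto
    hence "(\<Sum>k\<in>{P<..Suc n}. 1 / (real k)\<^sup>2) \<le> 1 / real P - 1 / real n + 1 / (real (Suc n))\<^sup>2"
      using step by simp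
    also have "1 / (real (Suc n))\<^sup>2 \<le> 1 / (real n * real (Suc n))"
      using n_pos by (intro divide_left_mono) (auto simp: power2_eq_square)
    also have "1 / (real n * real (Suc n)) = 1 / real n - 1 / real (Suc n)"
      using n_pos by (simp add: field_simps)
    finally show ?case by simp
  qed simp
  thus ?thesis by (cases "n \<ge> P") (auto intro: order_trans)
qed

lemma inverse_squares_summable_on: "(\<lambda>n. 1 / (real n)\<^sup>2) summable_on A"
proof (rule summable_on_subset_banach)
  show "(\<lambda>n. 1 / (real n)\<^sup>2) summable_on UNIV"
    using inverse_power_summable[of 2, where 'a = real]
    by (intro summable_nonneg_imp_summable_on) (auto simp: inverse_eq_divide)
qed auto

definition indivisible_by :: "nat set \<Rightarrow> nat set" where
  "indivisible_by S = {n. n > 0 \<and> (\<forall>p\<in>S. \<not> p dvd n)}"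

lemma indivisible_by_insert_decomp:
  assumes "prime p" "\<And>r. r \<in> S \<Longrightarrow> prime r" "p \<notin> S"
  shows "indivisible_by S = indivisible_by (insert p S) \<union> (*) p ` indivisible_by S"
proof -
  have "p * n \<in> indivisible_by S \<longleftrightarrow> n \<in> indivisible_by S" for n
  proof -
    have "r dvd p * n \<longleftrightarrow> r dvd n" if "r \<in> S" for r
      using assms that by (metis prime_dvd_distinct_prime_mult_iff)
    thus ?thesis using prime_gt_0_nat[OF assms(1)] by (simp add: indivisible_by_def)
  qed
  hence "(*) p ` indivisible_by S = {n\<in>indivisible_by S. p dvd n}" by (auto elim!: dvdE)
  moreover have "indivisible_by (insert p S) = {n\<in>indivisible_by S. \<not> p dvd n}"
    by (auto simp: indivisible_by_def)
  ultimately show ?thesis by blast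
qed

lemma infsum_inverse_squares_indivisible_by:
  assumes "finite S" "\<And>p. p \<in> S \<Longrightarrow> prime p"
  shows "infsum (\<lambda>n. 1 / (real n)\<^sup>2) (indivisible_by S)
       = (\<Prod>p\<in>S. 1 - 1 / (real p)\<^sup>2) * infsum (\<lambda>n. 1 / (real n)\<^sup>2) (indivisible_by {})"
  using assms
proof (induction S rule: finite_induct)
  case (insert p S)
  let ?f = "\<lambda>n. 1 / (real n)\<^sup>2"
  have prime_p: "prime p" "p > 0" using insert.prems prime_gt_0_nat[of p] by auto
  have "infsum ?f (indivisible_by S)
      = infsum ?f (indivisible_by (insert p S) \<union> (*) p ` indivisible_by S)"
    using indivisible_by_insert_decomp[of p S] insert by simp
  also have "\<dots> = infsum ?f (indivisible_by (insert p S)) + infsum ?f ((*) p ` indivisible_by S)"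
    by (intro infsum_Un_disjoint inverse_squares_summable_on) (auto simp: indivisible_by_def)
  also have "infsum ?f ((*) p ` indivisible_by S)
      = infsum (\<lambda>n. 1 / (real p)\<^sup>2 * ?f n) (indivisible_by S)"
    using prime_p by (subst infsum_reindex) (auto simp: inj_on_def o_def power_mult_distrib)
  also have "\<dots> = 1 / (real p)\<^sup>2 * infsum ?f (indivisible_by S)"
    by (rule infsum_cmult_right')
  finally have "infsum ?f (indivisible_by (insert p S))
      = (1 - 1 / (real p)\<^sup>2) * infsum ?f (indivisible_by S)"
    by (simp add: algebra_simps)
  thus ?case using insert by (simp add: mult.assoc)
qed simp

lemma zeta_2_eq_infsum: "zeta 2 = infsum (\<lambda>n. 1 / (real n)\<^sup>2) (indivisible_by {})"
proof -
  let ?f = "\<lambda>n. 1 / (real n)\<^sup>2"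
  have "(?f \<circ> Suc) summable_on UNIV"
    by (subst summable_on_reindex[symmetric]) (auto intro: inverse_squares_summable_on)
  hence "(?f \<circ> Suc) sums infsum (?f \<circ> Suc) UNIV"
    by (intro has_sum_imp_sums has_sum_infsum)
  also have "infsum (?f \<circ> Suc) UNIV = infsum ?f (range Suc)"
    by (simp add: infsum_reindex)
  also have "range Suc = indivisible_by {}"
    by (auto simp: indivisible_by_def image_iff gr0_conv_Suc)
  finally show ?thesis by (simp add: zeta_def o_def powr_numeral sums_iff)
qed

lemma infsum_inverse_squares_ge_1:
  assumes "1 \<in> A"
  shows "infsum (\<lambda>n. 1 / (real n)\<^sup>2) A \<ge> 1"
  using infsum_mono2[of "\<lambda>n. 1 / (real n)\<^sup>2" "{1}" A] assms
  by (simp add: inverse_squares_summable_on)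

lemma infsum_inverse_squares_le:
  assumes "P \<ge> 1" "\<And>n. n \<in> A \<Longrightarrow> n \<noteq> 1 \<Longrightarrow> n > P"
  shows "infsum (\<lambda>n. 1 / (real n)\<^sup>2) A \<le> 1 + 1 / real P"
proof (rule infsum_le_finite_sums[OF inverse_squares_summable_on])
  let ?f = "\<lambda>n. 1 / (real n)\<^sup>2"
  fix B assume B_subset: "finite B" "B \<subseteq> A"
  define N where "N = Max (insert 0 B)"
  have "sum ?f B \<le> sum ?f (insert 1 {P<..N})"
  proof (intro sum_mono2)
    show "B \<subseteq> insert 1 {P<..N}"
      using B_subset assms(2) Max_ge[of "insert 0 B"] by (auto simp: N_def subset_iff)
  qed auto
  also have "\<dots> = 1 + sum ?f {P<..N}" using assms by simp
  also have "\<dots> \<le> 1 + 1 / real P" using sum_inverse_squares_tail[OF assms(1)] by simp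
  finally show "sum ?f B \<le> 1 + 1 / real P" .
qed

lemma zeta_2_ge_1: "zeta 2 \<ge> 1"
  unfolding zeta_2_eq_infsum by (intro infsum_inverse_squares_ge_1) (simp add: indivisible_by_def)

lemma indivisible_by_primes_gt:
  assumes "n \<in> indivisible_by {p. prime p \<and> p \<le> P}" "n \<noteq> 1"
  shows "n > P"
proof -
  obtain p where "prime p" "p dvd n" using assms(2) prime_factor_nat by blast
  hence "p \<le> n" "\<not> p \<le> P" using assms(1) by (auto simp: indivisible_by_def intro: dvd_imp_le)
  thus ?thesis by simp
qed

lemma euler_product_zeta_2:
  "(\<lambda>P. \<Prod>p | prime p \<and> p \<le> P. 1 - 1 / (real p)\<^sup>2) \<longlonglongrightarrow> 1 / zeta 2"
proof -
  let ?E = "\<lambda>P. \<Prod>p | prime p \<and> p \<le> P. 1 - 1 / (real p)\<^sup>2"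
  have partial_product: "?E P * zeta 2
      = infsum (\<lambda>n. 1 / (real n)\<^sup>2) (indivisible_by {p. prime p \<and> p \<le> P})" for P
    by (subst infsum_inverse_squares_indivisible_by) (auto simp: zeta_2_eq_infsum)
  have "(\<lambda>P. ?E P * zeta 2) \<longlonglongrightarrow> 1"
  proof (rule tendsto_sandwich[of "\<lambda>_. 1" _ _ "\<lambda>P. 1 + 1 / real P"])
    show "\<forall>\<^sub>F P in sequentially. 1 \<le> ?E P * zeta 2"
      unfolding partial_product by (intro always_eventually allI infsum_inverse_squares_ge_1)
        (auto simp: indivisible_by_def dest: prime_gt_1_nat)
    show "\<forall>\<^sub>F P in sequentially. ?E P * zeta 2 \<le> 1 + 1 / real P"
      using eventually_ge_at_top[of 1] unfolding partial_product
      by eventually_elim (intro infsum_inverse_squares_le indivisible_by_primes_gt)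
  qed (auto intro!: tendsto_eq_intros lim_1_over_n)
  from tendsto_mult_right[OF this, of "1 / zeta 2"] show ?thesis using zeta_2_ge_1 by simp
qed

definition euler_factor :: "nat \<Rightarrow> nat \<Rightarrow> real" where
  "euler_factor m p = (if prime p \<and> \<not> p dvd m then 1 - 1 / (real p)\<^sup>2 else 1)"

lemma convergent_prod_euler_factor: "convergent_prod (euler_factor m)"
proof -
  have "summable (\<lambda>n. 1 / (real n)\<^sup>2)"
    using inverse_power_summable[of 2, where 'a = real] by (simp add: inverse_eq_divide)
  hence "summable (\<lambda>n. norm (euler_factor m n - 1))"
    by (rule summable_comparison_test') (auto simp: euler_factor_def)
  thus ?thesis
    by (intro abs_convergent_prod_imp_convergent_prod) (simp add: abs_convergent_prod_conv_summable)
qed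

lemma prod_euler_factor:
  "(\<Prod>p\<le>P. euler_factor m p) = (\<Prod>p | p \<le> P \<and> prime p \<and> \<not> p dvd m. 1 - 1 / (real p)\<^sup>2)"
  unfolding euler_factor_def by (subst prod.inter_filter[symmetric]) (auto intro!: prod.cong)

lemma prime_inverse_square_less_1:
  assumes "prime p"
  shows "1 / (real p)\<^sup>2 < 1"
  using prime_gt_1_nat[OF assms] by simp

lemma C_pos:
  assumes "m > 0"
  shows "C m > 0"
  unfolding C_def using assms zeta_2_ge_1
  by (intro mult_pos_pos divide_pos_pos prod_pos) (auto simp: prime_inverse_square_less_1)

lemma prodinf_euler_factor:
  assumes "m > 0"
  shows "prodinf (euler_factor m) * (\<Prod>p | prime p \<and> p dvd m. 1 - 1 / (real p)\<^sup>2) = 1 / zeta 2"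
proof -
  define E where "E = (\<Prod>p | prime p \<and> p dvd m. 1 - 1 / (real p)\<^sup>2)"
  have partial_product: "(\<Prod>p\<le>P. euler_factor m p) * E
      = (\<Prod>p | prime p \<and> p \<le> P. 1 - 1 / (real p)\<^sup>2)"
    if "P \<ge> m" for P
  proof -
    have "{p. prime p \<and> p \<le> P} = {p. p \<le> P \<and> prime p \<and> \<not> p dvd m} \<union> {p. prime p \<and> p dvd m}"
      using that assms by (auto dest!: dvd_imp_le)
    moreover have "finite {p. prime p \<and> p dvd m}" using assms by simp
    ultimately show ?thesis
      unfolding E_def prod_euler_factor by (simp only:) (subst prod.union_disjoint[symmetric], auto)
  qed
  have "\<forall>\<^sub>F P in sequentially. (\<Prod>p | prime p \<and> p \<le> P. 1 - 1 / (real p)\<^sup>2)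
      = (\<Prod>p\<le>P. euler_factor m p) * E"
    using eventually_ge_at_top[of m] by eventually_elim (simp add: partial_product)
  with euler_product_zeta_2 have "(\<lambda>P. (\<Prod>p\<le>P. euler_factor m p) * E) \<longlonglongrightarrow> 1 / zeta 2"
    by (rule Lim_transform_eventually)
  moreover have "(\<lambda>P. (\<Prod>p\<le>P. euler_factor m p) * E) \<longlonglongrightarrow> prodinf (euler_factor m) * E"
    by (intro tendsto_mult_right convergent_prod_LIMSEQ convergent_prod_euler_factor)
  ultimately have "1 / zeta 2 = prodinf (euler_factor m) * E" by (rule LIMSEQ_unique)
  thus ?thesis by (simp add: E_def)
qed

lemma C_eq_prodinf:
  assumes "m > 0"
  shows "C m = totient_density m * prodinf (euler_factor m)"
proof -
  define E where "E = (\<Prod>p | prime p \<and> p dvd m. 1 - 1 / (real p)\<^sup>2)"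
  have "E > 0" unfolding E_def by (intro prod_pos) (auto simp: prime_inverse_square_less_1)
  hence "prodinf (euler_factor m) = 1 / (zeta 2 * E)"
    using prodinf_euler_factor[OF assms] zeta_2_ge_1 by (simp add: E_def[symmetric] field_simps)
  moreover have "(\<Prod>p | prime p \<and> p dvd m. inverse (1 - 1 / (real p)\<^sup>2)) = 1 / E"
    by (simp add: E_def inverse_eq_divide prod_dividef)
  ultimately show ?thesis unfolding C_def totient_density_def by simp
qed

definition coprime_totient_density :: "nat \<Rightarrow> nat \<Rightarrow> real" where
  "coprime_totient_density m q = (if coprime q m then totient_density q else 0)"

lemma coprime_totient_density_nonneg: "coprime_totient_density m q \<ge> 0"
  by (simp add: coprime_totient_density_def totient_density_def)

definition truncated_density :: "nat \<Rightarrow> nat \<Rightarrow> nat \<Rightarrow> real" where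
  "truncated_density m P =
     sieve_weight (\<lambda>p. if p dvd m then 1 else 1 / real p) ({p. prime p \<and> p \<le> P} \<union> prime_factors m)"

lemma truncated_density_not_coprime:
  assumes "m > 0" "\<not> coprime q m"
  shows "truncated_density m P q = 0"
proof -
  obtain p where "p \<in> prime_factors m" "p dvd q"
    using assms coprime_iff_prime_factors_not_dvd by blast
  thus ?thesis
    unfolding truncated_density_def sieve_weight_def using assms(1)
    by (intro prod_zero bexI[of _ p]) (auto simp: in_prime_factors_iff)
qed

lemma truncated_density_coprime:
  assumes "m > 0" "q > 0" "coprime q m"
  shows "truncated_density m P q = (\<Prod>p | p \<in> prime_factors q \<and> p \<le> P. 1 - 1 / real p)"
proof -
  have not_dvd: "\<not> p dvd m" if "p dvd q" "prime p" for p
    using that assms(3) by (metis coprime_common_divisor not_prime_unit)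
  show ?thesis
    unfolding truncated_density_def sieve_weight_def
    by (rule prod.mono_neutral_cong_right) (use assms not_dvd in \<open>auto simp: in_prime_factors_iff\<close>)
qed

lemma abs_truncated_density_diff_le:
  assumes "m > 0" "q > 0"
  shows "\<bar>truncated_density m P q - coprime_totient_density m q\<bar>
       \<le> (\<Sum>p | p \<in> prime_factors q \<and> p > P. 1 / real p)"
proof (cases "coprime q m")
  case False
  thus ?thesis
    using assms
    by (auto simp: truncated_density_not_coprime coprime_totient_density_def intro!: sum_nonneg)
next
  case True
  define A B where "A = {p. p \<in> prime_factors q \<and> p \<le> P}" and "B = {p. p \<in> prime_factors q \<and> p > P}"
  have reciprocal_bounds: "1 / real p \<in> {0..1}" if "p \<in> prime_factors q" for p
    using prime_gt_0_nat[OF in_prime_factors_imp_prime[OF that]] by auto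
  have partition: "prime_factors q = A \<union> B" "A \<inter> B = {}" "finite A" "finite B"
    by (auto simp: A_def B_def)
  have "coprime_totient_density m q = (\<Prod>p\<in>A. 1 - 1 / real p) * (\<Prod>p\<in>B. 1 - 1 / real p)"
    using True assms partition
    by (simp add: coprime_totient_density_def totient_density_eq_prod prod.union_disjoint)
  hence "truncated_density m P q - coprime_totient_density m q
      = (\<Prod>p\<in>A. 1 - 1 / real p) * (1 - (\<Prod>p\<in>B. 1 - 1 / real p))"
    using truncated_density_coprime[OF assms True] by (simp add: A_def algebra_simps)
  moreover have "(\<Prod>p\<in>A. 1 - 1 / real p) \<in> {0..1}" "(\<Prod>p\<in>B. 1 - 1 / real p) \<le> 1"
    using reciprocal_bounds by (auto intro!: prod_nonneg prod_le_1 simp: partition(1))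
  moreover have "1 - (\<Sum>p\<in>B. 1 / real p) \<le> (\<Prod>p\<in>B. 1 - 1 / real p)"
    using reciprocal_bounds by (intro Weierstrass_prod_ineq) (auto simp: partition(1))
  ultimately have "\<bar>truncated_density m P q - coprime_totient_density m q\<bar> \<le> 1 * (\<Sum>p\<in>B. 1 / real p)"
    by (simp only: abs_mult) (intro mult_mono, auto)
  thus ?thesis by (simp add: B_def)
qed

lemma sum_reciprocal_large_prime_factors_le:
  assumes "P \<ge> 1"
  shows "(\<Sum>q\<in>{1..n}. \<Sum>p | p \<in> prime_factors q \<and> p > P. 1 / real p) \<le> real n / real P"
proof -
  have "(\<Sum>q\<in>{1..n}. \<Sum>p | p \<in> prime_factors q \<and> p > P. 1 / real p)
      \<le> (\<Sum>q\<in>{1..n}. \<Sum>p | p \<in> {P<..n} \<and> p dvd q. 1 / real p)"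
    by (intro sum_mono sum_mono2) (auto simp: in_prime_factors_iff dest: dvd_imp_le)
  also have "\<dots> = (\<Sum>p\<in>{P<..n}. \<Sum>q | q \<in> nats_between 0 (real n) \<and> p dvd q. 1 / real p)"
    unfolding nats_between_0_of_nat by (rule sum.swap_restrict) auto
  also have "\<dots> = (\<Sum>p\<in>{P<..n}. real (nat \<lfloor>real n / real p\<rfloor>) * (1 / real p))"
    by (intro sum.cong refl, subst sum_multiples_nats_between) (auto simp: nats_between_eq_floor)
  also have "\<dots> \<le> (\<Sum>p\<in>{P<..n}. real n / real p * (1 / real p))"
    by (intro sum_mono mult_right_mono) (auto simp: of_nat_floor)
  also have "\<dots> = real n * (\<Sum>p\<in>{P<..n}. 1 / (real p)\<^sup>2)"
    by (simp add: sum_distrib_left power2_eq_square)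
  also have "\<dots> \<le> real n * (1 / real P)"
    using sum_inverse_squares_tail[OF assms] by (intro mult_left_mono) auto
  finally show ?thesis by simp
qed

lemma prod_truncated_density:
  assumes "m > 0"
  shows "(\<Prod>p\<in>{p. prime p \<and> p \<le> P} \<union> prime_factors m. 1 - (if p dvd m then 1 else 1 / real p) / real p)
       = totient_density m * (\<Prod>p\<le>P. euler_factor m p)"
proof -
  let ?g = "\<lambda>p. 1 - (if p dvd m then 1 else 1 / real p) / real p"
  have "{p. prime p \<and> p \<le> P} \<union> prime_factors m = prime_factors m \<union> {p. p \<le> P \<and> prime p \<and> \<not> p dvd m}"
    using assms by (auto simp: in_prime_factors_iff)
  hence "(\<Prod>p\<in>{p. prime p \<and> p \<le> P} \<union> prime_factors m. ?g p)
      = (\<Prod>p\<in>prime_factors m. ?g p) * (\<Prod>p | p \<le> P \<and> prime p \<and> \<not> p dvd m. ?g p)"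
    by (simp only:) (subst prod.union_disjoint, auto)
  also have "(\<Prod>p\<in>prime_factors m. ?g p) = totient_density m"
    unfolding totient_density_eq_prod[OF assms] by (intro prod.cong) auto
  also have "(\<Prod>p | p \<le> P \<and> prime p \<and> \<not> p dvd m. ?g p) = (\<Prod>p\<le>P. euler_factor m p)"
    unfolding prod_euler_factor by (intro prod.cong) (auto simp: power2_eq_square)
  finally show ?thesis .
qed

lemma mean_truncated_density:
  assumes "m > 0"
  shows "(\<lambda>n. (\<Sum>q\<in>{1..n}. truncated_density m P q) / real n)
           \<longlonglongrightarrow> totient_density m * (\<Prod>p\<le>P. euler_factor m p)"
proof (rule tendsto_divide_of_approx)
  let ?S = "{p. prime p \<and> p \<le> P} \<union> prime_factors m"
  have "\<bar>(\<Sum>q\<in>{1..n}. truncated_density m P q) - totient_density m * (\<Prod>p\<le>P. euler_factor m p) * real n\<bar>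
      \<le> 2 ^ card ?S" for n
  proof -
    have "\<bar>sum (truncated_density m P) (nats_between 0 (real n))
        - (real n - 0) * (\<Prod>p\<in>?S. 1 - (if p dvd m then 1 else 1 / real p) / real p)\<bar> \<le> 2 ^ card ?S"
      unfolding truncated_density_def by (rule sum_sieve_weight) (auto simp: divide_le_eq)
    thus ?thesis
      unfolding prod_truncated_density[OF assms] nats_between_0_of_nat by (simp add: mult.commute)
  qed
  thus "\<forall>\<^sub>F n in sequentially. \<bar>(\<Sum>q\<in>{1..n}. truncated_density m P q)
      - totient_density m * (\<Prod>p\<le>P. euler_factor m p) * real n\<bar> \<le> 2 ^ card ?S"
    by (intro always_eventually allI)
  show "(\<lambda>n. 2 ^ card ?S / real n) \<longlonglongrightarrow> 0" by (rule lim_const_over_n)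
qed (use eventually_gt_at_top[of "0::nat"] in \<open>auto elim: eventually_mono\<close>)

lemma mean_truncated_density_approx:
  assumes "m > 0" "P \<ge> 1"
  shows "\<bar>(\<Sum>q\<in>{1..n}. truncated_density m P q) / real n
           - (\<Sum>q\<in>{1..n}. coprime_totient_density m q) / real n\<bar> \<le> 1 / real P"
proof -
  have "\<bar>\<Sum>q\<in>{1..n}. truncated_density m P q - coprime_totient_density m q\<bar>
      \<le> (\<Sum>q\<in>{1..n}. \<Sum>p | p \<in> prime_factors q \<and> p > P. 1 / real p)"
    using assms by (intro order_trans[OF sum_abs] sum_mono abs_truncated_density_diff_le) auto
  also have "\<dots> \<le> real n / real P" by (rule sum_reciprocal_large_prime_factors_le[OF assms(2)])
  finally show ?thesis
    by (simp add: sum_subtractf divide_simps flip: diff_divide_distrib split: if_splits)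
qed

text \<open>The means of the truncated densities approach that of \<open>coprime_totient_density m\<close> uniformly in
  the range of summation, so the two limits may be interchanged.\<close>

lemma mean_coprime_totient_density:
  assumes "m > 0"
  shows "(\<lambda>n. (\<Sum>q\<in>{1..n}. coprime_totient_density m q) / real n) \<longlonglongrightarrow> C m"
proof (rule swap_uniform_limit')
  show "\<forall>\<^sub>F P in sequentially. (\<lambda>n. (\<Sum>q\<in>{1..n}. truncated_density m P q) / real n)
      \<longlonglongrightarrow> totient_density m * (\<Prod>p\<le>P. euler_factor m p)"
    using mean_truncated_density[OF assms] by simp
  show "(\<lambda>P. totient_density m * (\<Prod>p\<le>P. euler_factor m p)) \<longlonglongrightarrow> C m"
    unfolding C_eq_prodinf[OF assms]
    by (intro tendsto_mult_left convergent_prod_LIMSEQ convergent_prod_euler_factor)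
  show "uniform_limit UNIV (\<lambda>P n. (\<Sum>q\<in>{1..n}. truncated_density m P q) / real n)
      (\<lambda>n. (\<Sum>q\<in>{1..n}. coprime_totient_density m q) / real n) sequentially"
  proof (rule uniform_limitI)
    fix e :: real assume "e > 0"
    hence "\<forall>\<^sub>F P in sequentially. 1 / real P < e" by (rule order_tendstoD(2)[OF lim_1_over_n])
    thus "\<forall>\<^sub>F P in sequentially. \<forall>n\<in>UNIV. dist ((\<Sum>q\<in>{1..n}. truncated_density m P q) / real n)
        ((\<Sum>q\<in>{1..n}. coprime_totient_density m q) / real n) < e"
      using eventually_ge_at_top[of 1]
    proof eventually_elim
      case (elim P)
      thus ?case
        unfolding dist_real_def
        by (blast intro: le_less_trans mean_truncated_density_approx[OF assms])
    qed
  qed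
qed auto

section \<open>Weighted Riemann sums\<close>

lemma nat_floor_div_tendsto:
  fixes x :: real
  assumes "x \<ge> 0"
  shows "(\<lambda>n. real (nat \<lfloor>x * real n\<rfloor>) / real n) \<longlonglongrightarrow> x"
proof (rule tendsto_sandwich)
  show "\<forall>\<^sub>F n in sequentially. x - 1 / real n \<le> real (nat \<lfloor>x * real n\<rfloor>) / real n"
    using eventually_gt_at_top[of 0]
  proof eventually_elim
    case (elim n)
    have "x * real n - 1 \<le> real (nat \<lfloor>x * real n\<rfloor>)" by linarith
    hence "(x * real n - 1) / real n \<le> real (nat \<lfloor>x * real n\<rfloor>) / real n"
      by (rule divide_right_mono) simp
    thus ?case using elim by (simp add: diff_divide_distrib)
  qed
  show "\<forall>\<^sub>F n in sequentially. real (nat \<lfloor>x * real n\<rfloor>) / real n \<le> x"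
    using eventually_gt_at_top[of 0]
    by eventually_elim (use assms of_nat_floor in \<open>simp add: divide_le_eq\<close>)
  show "(\<lambda>n. x - 1 / real n) \<longlonglongrightarrow> x"
    using tendsto_diff[OF tendsto_const lim_1_over_n, of x] by simp
qed simp

lemma scaled_partial_sums_tendsto:
  fixes f :: "nat \<Rightarrow> real"
  assumes mean: "(\<lambda>n. (\<Sum>q\<in>{1..n}. f q) / real n) \<longlonglongrightarrow> B" and "x \<ge> 0"
  shows "(\<lambda>n. (\<Sum>q\<in>{1..nat \<lfloor>x * real n\<rfloor>}. f q) / real n) \<longlonglongrightarrow> B * x"
proof (cases "x = 0")
  case False
  define N where "N n = nat \<lfloor>x * real n\<rfloor>" for n
  have "filterlim (\<lambda>n. x * real n) at_top sequentially"
    using assms(2) False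
    by (intro filterlim_tendsto_pos_mult_at_top[OF tendsto_const] filterlim_real_sequentially) auto
  hence N_at_top: "filterlim N at_top sequentially"
    unfolding N_def
    by (intro filterlim_compose[OF filterlim_nat_sequentially]
        filterlim_compose[OF filterlim_floor_sequentially])
  have "(\<lambda>n. (\<Sum>q\<in>{1..N n}. f q) / real (N n) * (real (N n) / real n)) \<longlonglongrightarrow> B * x"
    using filterlim_compose[OF mean N_at_top] nat_floor_div_tendsto[OF assms(2)]
    by (intro tendsto_mult) (auto simp: N_def)
  moreover have "\<forall>\<^sub>F n in sequentially. (\<Sum>q\<in>{1..N n}. f q) / real (N n) * (real (N n) / real n)
      = (\<Sum>q\<in>{1..N n}. f q) / real n"
    using eventually_compose_filterlim[OF eventually_gt_at_top[of 0] N_at_top]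
    by eventually_elim simp
  ultimately show ?thesis unfolding N_def by (rule Lim_transform_eventually)
qed simp

definition weighted_points :: "(nat \<Rightarrow> real) \<Rightarrow> nat \<Rightarrow> real measure" where
  "weighted_points f n =
     distr (point_measure {1..n} (\<lambda>q. ennreal (f q / (\<Sum>k\<in>{1..n}. f k)))) borel
       (\<lambda>q. real q / real n)"

lemma real_distribution_weighted_points:
  assumes "\<And>q. f q > 0" "n > 0"
  shows "real_distribution (weighted_points f n)"
proof -
  have "(\<Sum>k\<in>{1..n}. f k) > 0" using assms by (intro sum_pos) auto
  hence "(\<Sum>q\<in>{1..n}. ennreal (f q / (\<Sum>k\<in>{1..n}. f k))) = 1"
    using assms by (subst sum_ennreal) (auto simp: less_imp_le simp flip: sum_divide_distrib)
  hence "prob_space (point_measure {1..n} (\<lambda>q. ennreal (f q / (\<Sum>k\<in>{1..n}. f k))))"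
    by (intro prob_space_point_measure) auto
  thus ?thesis unfolding weighted_points_def
    by (rule prob_space.real_distribution_distr) simp
qed

lemma integral_weighted_points:
  fixes h :: "real \<Rightarrow> real"
  assumes "\<And>q. f q > 0" "h \<in> borel_measurable borel"
  shows "integral\<^sup>L (weighted_points f n) h
       = (\<Sum>q\<in>{1..n}. f q * h (real q / real n)) / (\<Sum>q\<in>{1..n}. f q)"
proof -
  have "integral\<^sup>L (weighted_points f n) h
      = integral\<^sup>L (point_measure {1..n} (\<lambda>q. ennreal (f q / (\<Sum>k\<in>{1..n}. f k))))
          (\<lambda>q. h (real q / real n))"
    unfolding weighted_points_def using assms(2) by (intro integral_distr) auto
  also have "\<dots> = (\<Sum>q\<in>{1..n}. f q / (\<Sum>k\<in>{1..n}. f k) * h (real q / real n))"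
    using assms(1)[THEN less_imp_le] by (subst lebesgue_integral_point_measure_finite)
      (auto intro!: divide_nonneg_nonneg sum_nonneg)
  finally show ?thesis by (simp add: sum_divide_distrib)
qed

lemma cdf_weighted_points:
  assumes "\<And>q. f q > 0" "n > 0"
  shows "cdf (weighted_points f n) x = (\<Sum>q\<in>{1..nat \<lfloor>min 1 x * real n\<rfloor>}. f q) / (\<Sum>q\<in>{1..n}. f q)"
proof -
  interpret real_distribution "weighted_points f n"
    by (rule real_distribution_weighted_points[OF assms])
  have "cdf (weighted_points f n) x = integral\<^sup>L (weighted_points f n) (indicator {..x})"
    by (simp add: cdf_def)
  also have "\<dots> = (\<Sum>q\<in>{1..n}. f q * indicator {..x} (real q / real n)) / (\<Sum>q\<in>{1..n}. f q)"
    by (rule integral_weighted_points[OF assms(1)]) simp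
  also have "(\<Sum>q\<in>{1..n}. f q * indicator {..x} (real q / real n))
      = (\<Sum>q | q \<in> {1..n} \<and> real q / real n \<le> x. f q)"
    by (rule sum.mono_neutral_cong_right) (auto simp: indicator_def)
  also have "{q. q \<in> {1..n} \<and> real q / real n \<le> x} = nats_between 0 (min 1 x * real n)"
    using assms(2) by (auto simp: nats_between_def min_mult_distrib_right pos_divide_le_eq)
  finally show ?thesis by (simp add: nats_between_eq_floor atLeastSucAtMost_greaterThanAtMost)
qed

definition uniform_unit_interval :: "real measure" where
  "uniform_unit_interval = uniform_measure lborel {0..1}"

lemma real_distribution_uniform_unit_interval: "real_distribution uniform_unit_interval"
proof -
  have "prob_space uniform_unit_interval"
    unfolding uniform_unit_interval_def by (rule prob_space_uniform_measure) auto
  thus ?thesis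
    by (simp add: real_distribution_def real_distribution_axioms_def uniform_unit_interval_def)
qed

lemma cdf_uniform_unit_interval: "cdf uniform_unit_interval x = max 0 (min 1 x)"
proof -
  have "{0..1} \<inter> {..x} = {0..min 1 x}" by auto
  thus ?thesis
    by (simp add: cdf_def uniform_unit_interval_def)
qed

lemma integral_uniform_unit_interval:
  fixes h :: "real \<Rightarrow> real"
  assumes "h \<in> borel_measurable borel" "continuous_on {0..1} h"
  shows "integral\<^sup>L uniform_unit_interval h = integral {0..1} h"
proof -
  have "integral\<^sup>L uniform_unit_interval h
      = integral\<^sup>L (density lborel (\<lambda>x. ennreal (indicator {0..1} x))) h"
    by (simp add: uniform_unit_interval_def uniform_measure_def ennreal_indicator divide_ennreal_def)
  also have "\<dots> = (LINT x:{0..1}|lborel. h x)"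
    unfolding set_lebesgue_integral_def using assms by (intro integral_density) auto
  also have "\<dots> = integral {0..1} h"
    by (intro set_borel_integral_eq_integral borel_integrable_atLeastAtMost' assms)
  finally show ?thesis .
qed

lemma weak_conv_weighted_points:
  assumes "\<And>q. f q > 0" "(\<lambda>n. (\<Sum>q\<in>{1..n}. f q) / real n) \<longlonglongrightarrow> B" "B > 0"
  shows "weak_conv_m (\<lambda>n. weighted_points f (Suc n)) uniform_unit_interval"
  unfolding weak_conv_m_def weak_conv_def
proof (intro allI impI)
  fix x :: real
  let ?S = "\<lambda>n. \<Sum>q\<in>{1..n}. f q"
  have "(\<lambda>n. cdf (weighted_points f n) x) \<longlonglongrightarrow> max 0 (min 1 x)"
  proof (cases "x \<ge> 0")
    case True
    have "(\<lambda>n. (?S (nat \<lfloor>min 1 x * real n\<rfloor>) / real n) / (?S n / real n)) \<longlonglongrightarrow> B * min 1 x / B"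
      using assms(3) True by (intro tendsto_divide scaled_partial_sums_tendsto assms(2)) auto
    moreover have "\<forall>\<^sub>F n in sequentially. (?S (nat \<lfloor>min 1 x * real n\<rfloor>) / real n) / (?S n / real n)
        = cdf (weighted_points f n) x"
      using eventually_gt_at_top[of 0] by eventually_elim (simp add: cdf_weighted_points assms(1))
    ultimately show ?thesis using assms(3) True by (auto intro: Lim_transform_eventually)
  next
    case False
    have floor_eq_0: "nat \<lfloor>min 1 x * real n\<rfloor> = 0" for n
      using False by (intro nat_floor_neg mult_nonpos_nonneg) auto
    have "\<forall>\<^sub>F n in sequentially. cdf (weighted_points f n) x = 0"
      using eventually_gt_at_top[of 0]
      by eventually_elim (simp add: cdf_weighted_points assms(1) floor_eq_0)
    thus ?thesis using False by (auto intro: tendsto_eventually)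
  qed
  thus "(\<lambda>n. cdf (weighted_points f (Suc n)) x) \<longlonglongrightarrow> cdf uniform_unit_interval x"
    unfolding cdf_uniform_unit_interval by (rule LIMSEQ_Suc)
qed

lemma weighted_riemann_sum_bounded:
  fixes f :: "nat \<Rightarrow> real" and h :: "real \<Rightarrow> real"
  assumes pos: "\<And>q. f q > 0"
    and mean: "(\<lambda>n. (\<Sum>q\<in>{1..n}. f q) / real n) \<longlonglongrightarrow> B" and "B > 0"
    and cont: "continuous_on UNIV h" and bound: "\<And>x. \<bar>h x\<bar> \<le> K"
  shows "(\<lambda>n. (\<Sum>q\<in>{1..n}. f q * h (real q / real n)) / real n) \<longlonglongrightarrow> B * integral {0..1} h"
proof -
  have measurable: "h \<in> borel_measurable borel"
    by (rule borel_measurable_continuous_onI[OF cont])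
  have "(\<lambda>n. integral\<^sup>L (weighted_points f (Suc n)) h) \<longlonglongrightarrow> integral\<^sup>L uniform_unit_interval h"
  proof (rule weak_conv_imp_integral_bdd_continuous_conv)
    show "isCont h x" for x using cont by (simp add: continuous_on_eq_continuous_at)
    show "norm (h x) \<le> K" for x using bound by simp
  qed (use assms in \<open>auto intro: real_distribution_weighted_points
      real_distribution_uniform_unit_interval weak_conv_weighted_points\<close>)
  also have "integral\<^sup>L uniform_unit_interval h = integral {0..1} h"
    by (intro integral_uniform_unit_interval measurable continuous_on_subset[OF cont]) simp
  finally have "(\<lambda>n. integral\<^sup>L (weighted_points f n) h) \<longlonglongrightarrow> integral {0..1} h"
    by (rule LIMSEQ_imp_Suc)
  hence "(\<lambda>n. (\<Sum>q\<in>{1..n}. f q) / real n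
      * ((\<Sum>q\<in>{1..n}. f q * h (real q / real n)) / (\<Sum>q\<in>{1..n}. f q))) \<longlonglongrightarrow> B * integral {0..1} h"
    unfolding integral_weighted_points[OF pos measurable] by (rule tendsto_mult[OF mean])
  moreover have "(\<Sum>q\<in>{1..n}. f q) / real n
        * ((\<Sum>q\<in>{1..n}. f q * h (real q / real n)) / (\<Sum>q\<in>{1..n}. f q))
      = (\<Sum>q\<in>{1..n}. f q * h (real q / real n)) / real n" for n
    using sum_pos[of "{1..n}" f] pos by (cases "n = 0") auto
  ultimately show ?thesis by simp
qed

lemma weighted_riemann_sum_pos:
  fixes f :: "nat \<Rightarrow> real" and h :: "real \<Rightarrow> real"
  assumes pos: "\<And>q. f q > 0"
    and mean: "(\<lambda>n. (\<Sum>q\<in>{1..n}. f q) / real n) \<longlonglongrightarrow> B" and "B > 0"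
    and cont: "continuous_on {0..1} h"
  shows "(\<lambda>n. (\<Sum>q\<in>{1..n}. f q * h (real q / real n)) / real n) \<longlonglongrightarrow> B * integral {0..1} h"
proof -
  define h' where "h' x = h (max 0 (min 1 x))" for x
  have h'_eq: "h' x = h x" if "x \<in> {0..1}" for x using that by (auto simp: h'_def)
  have h'_cont: "continuous_on UNIV h'"
    unfolding h'_def by (rule continuous_on_compose2[OF cont]) (auto intro!: continuous_intros)
  obtain K where h_bound: "\<And>x. x \<in> {0..1} \<Longrightarrow> norm (h x) \<le> K"
    using compact_imp_bounded[OF compact_continuous_image[OF cont compact_Icc]]
    unfolding bounded_iff by blast
  have "\<bar>h' x\<bar> \<le> K" for x using h_bound[of "max 0 (min 1 x)"] by (simp add: h'_def)
  hence "(\<lambda>n. (\<Sum>q\<in>{1..n}. f q * h' (real q / real n)) / real n) \<longlonglongrightarrow> B * integral {0..1} h'"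
    by (rule weighted_riemann_sum_bounded[OF pos mean \<open>B > 0\<close> h'_cont])
  moreover have "(\<Sum>q\<in>{1..n}. f q * h' (real q / real n)) = (\<Sum>q\<in>{1..n}. f q * h (real q / real n))"
    for n
    by (intro sum.cong refl) (auto simp: h'_eq)
  moreover have "integral {0..1} h' = integral {0..1} h"
    by (intro Henstock_Kurzweil_Integration.integral_cong h'_eq)
  ultimately show ?thesis by simp
qed

lemma weighted_riemann_sum:
  fixes f :: "nat \<Rightarrow> real" and h :: "real \<Rightarrow> real"
  assumes nonneg: "\<And>q. f q \<ge> 0"
    and mean: "(\<lambda>n. (\<Sum>q\<in>{1..n}. f q) / real n) \<longlonglongrightarrow> B"
    and cont: "continuous_on {0..1} h"
  shows "(\<lambda>n. (\<Sum>q\<in>{1..n}. f q * h (real q / real n)) / real n) \<longlonglongrightarrow> B * integral {0..1} h"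
proof -
  have "B \<ge> 0"
    by (rule tendsto_lowerbound[OF mean])
       (auto intro!: always_eventually divide_nonneg_nonneg sum_nonneg nonneg)
  have mean_one: "(\<lambda>n. (\<Sum>q\<in>{1..n}. 1) / real n) \<longlonglongrightarrow> (1::real)"
    by (rule tendsto_eventually) (use eventually_gt_at_top[of 0] in eventually_elim, simp)
  have "(\<lambda>n. (\<Sum>q\<in>{1..n}. f q + 1) / real n) \<longlonglongrightarrow> B + 1"
    using tendsto_add[OF mean mean_one] by (simp add: sum.distrib add_divide_distrib)
  hence "(\<lambda>n. (\<Sum>q\<in>{1..n}. (f q + 1) * h (real q / real n)) / real n) \<longlonglongrightarrow> (B + 1) * integral {0..1} h"
    using nonneg \<open>B \<ge> 0\<close> by (intro weighted_riemann_sum_pos cont) (auto simp: add_nonneg_pos)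
  moreover have "(\<lambda>n. (\<Sum>q\<in>{1..n}. 1 * h (real q / real n)) / real n) \<longlonglongrightarrow> 1 * integral {0..1} h"
    by (intro weighted_riemann_sum_pos mean_one cont) auto
  ultimately have "(\<lambda>n. (\<Sum>q\<in>{1..n}. (f q + 1) * h (real q / real n)) / real n
      - (\<Sum>q\<in>{1..n}. 1 * h (real q / real n)) / real n)
      \<longlonglongrightarrow> (B + 1) * integral {0..1} h - 1 * integral {0..1} h"
    by (rule tendsto_diff)
  thus ?thesis by (simp add: algebra_simps sum.distrib add_divide_distrib)
qed

lemma has_integral_zero_then_antiderivative:
  fixes f F :: "real \<Rightarrow> real"
  assumes "0 \<le> a" "a \<le> b" "\<And>x. x \<in> {0..a} \<Longrightarrow> f x = 0"
    "\<And>x. x \<in> {a..b} \<Longrightarrow> (F has_real_derivative f x) (at x within {a..b})"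
  shows "(f has_integral (F b - F a)) {0..b}"
proof -
  have "(f has_integral 0) {0..a}" using assms(3) by (intro has_integral_is_0) auto
  moreover have "(f has_integral (F b - F a)) {a..b}"
    using assms by (intro fundamental_theorem_of_calculus)
      (auto simp: has_real_derivative_iff_has_vector_derivative)
  ultimately have "(f has_integral (0 + (F b - F a))) {0..b}"
    using assms by (intro has_integral_combine[of 0 a b])
  thus ?thesis by simp
qed

text \<open>The area of the part of the unit square in which \<open>x y > t\<close>.\<close>

definition hyperbola_area :: "real \<Rightarrow> real" where
  "hyperbola_area t = (if t < 1 then 1 - t + t * ln t else 0)"

lemma integral_hyperbola_area:
  assumes "\<tau> > 0"
  shows "integral {0..1} (\<lambda>t. 1 - \<tau> / max t \<tau>) = hyperbola_area \<tau>"
proof (cases "\<tau> < 1")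
  case True
  have "((\<lambda>t. 1 - \<tau> / max t \<tau>) has_integral ((1 - \<tau> * ln 1) - (\<tau> - \<tau> * ln \<tau>))) {0..1}"
    using assms True
    by (intro has_integral_zero_then_antiderivative[where F = "\<lambda>t. t - \<tau> * ln t" and a = \<tau>])
       (auto intro!: derivative_eq_intros simp: max_def)
  thus ?thesis using True by (simp add: hyperbola_area_def integral_unique)
next
  case False
  have "integral {0..1} (\<lambda>t. 1 - \<tau> / max t \<tau>) = integral {0..1} (\<lambda>t::real. 0::real)"
    using False by (intro integral_cong) (auto simp: max_def)
  thus ?thesis using False by (simp add: hyperbola_area_def)
qed

section \<open>Pairs of fractions with given determinant\<close>

text \<open>The pairs \<open>a / q < b / s\<close> with \<open>b q - a s = D\<close>; only the first fraction is required to be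
  reduced. Since the distance is \<open>D / (q s)\<close>, the condition \<open>z < q s\<close> says that it is less than \<open>D / z\<close>.\<close>

definition det_pairs :: "nat \<Rightarrow> nat \<Rightarrow> real \<Rightarrow> real \<Rightarrow> nat \<Rightarrow> (nat \<times> nat \<times> nat \<times> nat) set" where
  "det_pairs m n y z D = {(a, q, b, s). q \<in> {1..n} \<and> coprime q m \<and> a \<in> totatives q \<and>
     real s \<le> y \<and> coprime s m \<and> b * q = a * s + D \<and> z < real q * real s}"

definition reduced_det_pairs :: "nat \<Rightarrow> nat \<Rightarrow> real \<Rightarrow> real \<Rightarrow> nat \<Rightarrow> (nat \<times> nat \<times> nat \<times> nat) set" where
  "reduced_det_pairs m n y z D = {(a, q, b, s) \<in> det_pairs m n y z D. coprime b s}"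

lemma det_pairs_eq_image:
  "det_pairs m n y z D = (\<lambda>(q, s, a). (a, q, (a * s + D) div q, s)) `
     (SIGMA q:{q\<in>{1..n}. coprime q m}.
        SIGMA s:{s\<in>nats_between (min y (z / real q)) y. coprime s m}. unit_solutions q D s)"
    (is "_ = ?f ` ?S")
proof (intro equalityI subsetI)
  fix x assume "x \<in> det_pairs m n y z D"
  then obtain a q b s where pair: "x = (a, q, b, s)" "q \<in> {1..n}" "coprime q m" "a \<in> totatives q"
    "real s \<le> y" "coprime s m" "b * q = a * s + D" "z < real q * real s"
    by (auto simp: det_pairs_def)
  hence "z / real q < real s" by (simp add: divide_less_eq mult.commute)
  moreover have "q dvd a * s + D" "(a * s + D) div q = b"
    using pair(2) by (simp_all flip: pair(7))
  ultimately show "x \<in> ?f ` ?S"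
    using pair by (intro image_eqI[of _ _ "(q, s, a)"])
      (auto simp: nats_between_def unit_solutions_def min_less_iff_disj)
next
  fix x assume "x \<in> ?f ` ?S"
  thus "x \<in> det_pairs m n y z D"
    by (auto simp: det_pairs_def nats_between_def unit_solutions_def min_less_iff_disj
        divide_less_eq mult.commute)
qed

lemma finite_det_pairs [simp]: "finite (det_pairs m n y z D)"
  unfolding det_pairs_eq_image by (intro finite_imageI finite_SigmaI) auto

lemma finite_reduced_det_pairs [simp]: "finite (reduced_det_pairs m n y z D)"
  by (rule finite_subset[OF _ finite_det_pairs[of m n y z D]]) (auto simp: reduced_det_pairs_def)

lemma card_det_pairs:
  "card (det_pairs m n y z D) = (\<Sum>q | q \<in> {1..n} \<and> coprime q m.
     \<Sum>s | s \<in> nats_between (min y (z / real q)) y \<and> coprime s m. card (unit_solutions q D s))"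
  unfolding det_pairs_eq_image
  by (subst card_image) (auto simp: inj_on_def card_SigmaI)

lemma card_det_pairs_approx:
  assumes "m > 0" "D > 0" "y \<ge> 0" "z \<ge> 0"
  shows "\<bar>real (card (det_pairs m n y z D))
            - totient_density m * (\<Sum>q\<in>{1..n}. coprime_totient_density m q * (y - min y (z / real q)))\<bar>
         \<le> 2 * real D * 2 ^ card (prime_factors m) * (real n * sqrt (real n))"
proof -
  define K where "K = 2 * real D * 2 ^ card (prime_factors m)"
  define Q where "Q = {q\<in>{1..n}. coprime q m}"
  define V where "V q = (\<Sum>s | s \<in> nats_between (min y (z / real q)) y \<and> coprime s m.
      real (card (unit_solutions q D s)))" for q
  define W where "W q = totient_density m * (totient_density q * (y - min y (z / real q)))" for q
  have inner_sum_bound: "\<bar>V q - W q\<bar> \<le> K * sqrt (real n)" if q_in_Q: "q \<in> Q" for q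
  proof -
    have "\<bar>V q - W q\<bar> \<le> real D * 2 ^ card (prime_factors m) * 2 ^ card (prime_factors q)"
      using sum_card_unit_solutions_approx[of q D m "min y (z / real q)" y] assms q_in_Q
      by (simp add: V_def W_def Q_def mult_ac)
    also have "\<dots> \<le> real D * 2 ^ card (prime_factors m) * (2 * sqrt (real n))"
      using two_power_card_prime_factors_le[of q] q_in_Q
      by (intro mult_left_mono) (auto simp: Q_def intro: order_trans)
    finally show ?thesis by (simp add: K_def mult_ac)
  qed
  have "(\<Sum>q\<in>{1..n}. coprime_totient_density m q * (y - min y (z / real q)))
      = (\<Sum>q\<in>Q. totient_density q * (y - min y (z / real q)))"
    unfolding Q_def by (rule sum.mono_neutral_cong_right) (auto simp: coprime_totient_density_def)
  hence "real (card (det_pairs m n y z D))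
      - totient_density m * (\<Sum>q\<in>{1..n}. coprime_totient_density m q * (y - min y (z / real q)))
      = (\<Sum>q\<in>Q. V q - W q)"
    by (simp add: card_det_pairs Q_def V_def W_def sum_subtractf sum_distrib_left)
  also have "\<bar>\<dots>\<bar> \<le> (\<Sum>q\<in>Q. K * sqrt (real n))"
    by (intro order_trans[OF sum_abs] sum_mono inner_sum_bound)
  also have "\<dots> \<le> (\<Sum>q\<in>{1..n}. K * sqrt (real n))"
    by (intro sum_mono2) (auto simp: Q_def K_def)
  finally show ?thesis by (simp add: K_def mult_ac)
qed

lemma diff_min_eq_hyperbola_height:
  fixes \<rho> \<theta> q n :: real
  assumes "\<rho> > 0" "\<theta> > 0" "q > 0" "n > 0"
  shows "\<rho> * n - min (\<rho> * n) (\<theta> * n\<^sup>2 / q) = \<rho> * n * (1 - (\<theta> / \<rho>) / max (q / n) (\<theta> / \<rho>))"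
proof (cases "q / n \<le> \<theta> / \<rho>")
  case True
  hence "\<rho> * n \<le> \<theta> * n\<^sup>2 / q" using assms by (simp add: field_simps power2_eq_square)
  thus ?thesis using True assms by (simp add: max_def min_def)
next
  case False
  hence "\<theta> * n\<^sup>2 / q \<le> \<rho> * n" using assms by (simp add: field_simps power2_eq_square)
  thus ?thesis using False assms by (simp add: max_def min_def field_simps power2_eq_square)
qed

lemma card_det_pairs_asymp:
  assumes "m > 0" "D > 0" "\<rho> > 0" "\<theta> > 0"
  shows "(\<lambda>n. real (card (det_pairs m n (\<rho> * real n) (\<theta> * (real n)\<^sup>2) D)) / (real n)\<^sup>2)
     \<longlonglongrightarrow> totient_density m * C m * \<rho> * hyperbola_area (\<theta> / \<rho>)"
proof (rule tendsto_divide_of_approx)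
  define \<tau> where "\<tau> = \<theta> / \<rho>"
  define h where "h t = 1 - \<tau> / max t \<tau>" for t
  define K where "K = 2 * real D * 2 ^ card (prime_factors m)"
  define M where "M = (\<lambda>n. totient_density m * \<rho>
      * ((\<Sum>q\<in>{1..n}. coprime_totient_density m q * h (real q / real n)) / real n))"
  have "\<tau> > 0" using assms by (simp add: \<tau>_def)
  hence "continuous_on {0..1} h"
    unfolding h_def by (intro continuous_intros) (auto simp: max_def)
  hence "M \<longlonglongrightarrow> totient_density m * \<rho> * (C m * integral {0..1} h)"
    unfolding M_def using assms
    by (intro tendsto_mult_left weighted_riemann_sum mean_coprime_totient_density
        coprime_totient_density_nonneg)
  also have "integral {0..1} h = hyperbola_area \<tau>"
    unfolding h_def using \<open>\<tau> > 0\<close> by (rule integral_hyperbola_area)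
  finally show "M \<longlonglongrightarrow> totient_density m * C m * \<rho> * hyperbola_area (\<theta> / \<rho>)"
    by (simp add: \<tau>_def mult_ac)
  show "\<forall>\<^sub>F n in sequentially.
      \<bar>real (card (det_pairs m n (\<rho> * real n) (\<theta> * (real n)\<^sup>2) D)) - M n * (real n)\<^sup>2\<bar>
      \<le> K * (real n * sqrt (real n))"
    using eventually_gt_at_top[of 0]
  proof eventually_elim
    case (elim n)
    have "(\<Sum>q\<in>{1..n}. coprime_totient_density m q *
          (\<rho> * real n - min (\<rho> * real n) (\<theta> * (real n)\<^sup>2 / real q)))
        = \<rho> * real n * (\<Sum>q\<in>{1..n}. coprime_totient_density m q * h (real q / real n))"
      unfolding sum_distrib_left
      by (intro sum.cong refl)
         (use assms elim in \<open>simp add: diff_min_eq_hyperbola_height h_def \<tau>_def\<close>)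
    hence "totient_density m * (\<Sum>q\<in>{1..n}. coprime_totient_density m q *
        (\<rho> * real n - min (\<rho> * real n) (\<theta> * (real n)\<^sup>2 / real q))) = M n * (real n)\<^sup>2"
      using elim by (simp add: M_def power2_eq_square)
    thus ?case
      using card_det_pairs_approx[of m D "\<rho> * real n" "\<theta> * (real n)\<^sup>2" n] assms
      by (simp add: K_def)
  qed
  show "(\<lambda>n. K * (real n * sqrt (real n)) / (real n)\<^sup>2) \<longlonglongrightarrow> 0" by real_asymp
qed (use eventually_gt_at_top[of "0::nat"] in \<open>auto elim: eventually_mono\<close>)

lemma scaled_in_det_pairs_iff:
  assumes "k > 0" "coprime k m"
  shows "(a, q, k * b, k * s) \<in> det_pairs m n y z (k * D)
     \<longleftrightarrow> (a, q, b, s) \<in> det_pairs m n (y / real k) (z / real k) D"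
proof -
  have "k * b * q = a * (k * s) + k * D \<longleftrightarrow> k * (b * q) = k * (a * s + D)"
    by (simp add: algebra_simps)
  hence "k * b * q = a * (k * s) + k * D \<longleftrightarrow> b * q = a * s + D" using assms(1) by simp
  moreover have "real (k * s) \<le> y \<longleftrightarrow> real s \<le> y / real k"
    "z < real q * real (k * s) \<longleftrightarrow> z / real k < real q * real s"
    using assms(1) by (simp_all add: field_simps)
  ultimately show ?thesis using assms(2) by (simp add: det_pairs_def)
qed

lemma card_det_pairs_gcd_eq:
  assumes "k > 0" "coprime k m"
  shows "card {(a, q, b, s). (a, q, b, s) \<in> det_pairs m n y z (k * D) \<and> gcd b s = k}
       = card (reduced_det_pairs m n (y / real k) (z / real k) D)"
proof -
  let ?f = "\<lambda>(a, q, b, s). (a, q, k * b, k * s)"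
  have gcd_iff: "gcd (k * b) (k * s) = k \<longleftrightarrow> coprime b s" for b s
    using assms(1) by (simp add: gcd_mult_distrib_nat[symmetric] coprime_iff_gcd_eq_1)
  have "{(a, q, b, s). (a, q, b, s) \<in> det_pairs m n y z (k * D) \<and> gcd b s = k}
      = ?f ` reduced_det_pairs m n (y / real k) (z / real k) D"
  proof (intro equalityI subsetI)
    fix x assume "x \<in> {(a, q, b, s). (a, q, b, s) \<in> det_pairs m n y z (k * D) \<and> gcd b s = k}"
    then obtain a q b s
      where pair: "x = (a, q, b, s)" "(a, q, b, s) \<in> det_pairs m n y z (k * D)" "gcd b s = k"
      by blast
    then obtain b' s' where "b = k * b'" "s = k * s'" by (metis dvdE gcd_dvd1 gcd_dvd2)
    with pair have "(a, q, b', s') \<in> reduced_det_pairs m n (y / real k) (z / real k) D"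
      "x = ?f (a, q, b', s')"
      by (simp_all add: reduced_det_pairs_def scaled_in_det_pairs_iff[OF assms] gcd_iff)
    thus "x \<in> ?f ` reduced_det_pairs m n (y / real k) (z / real k) D" by (rule image_eqI[rotated])
  qed (auto simp: reduced_det_pairs_def scaled_in_det_pairs_iff[OF assms] gcd_iff)
  also have "card \<dots> = card (reduced_det_pairs m n (y / real k) (z / real k) D)"
    by (rule card_image) (use assms(1) in \<open>auto simp: inj_on_def\<close>)
  finally show ?thesis .
qed

lemma card_det_pairs_eq_sum:
  assumes "D > 0"
  shows "card (det_pairs m n y z D) =
    (\<Sum>k | k dvd D \<and> coprime k m. card (reduced_det_pairs m n (y / real k) (z / real k) (D div k)))"
proof -
  let ?g = "\<lambda>(a, q, b, s). gcd b s"
  have "?g ` det_pairs m n y z D \<subseteq> {k. k dvd D \<and> coprime k m}"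
  proof (rule image_subsetI)
    fix x assume "x \<in> det_pairs m n y z D"
    then obtain a q b s where pair: "x = (a, q, b, s)" "b * q = a * s + D" "coprime s m"
      by (auto simp: det_pairs_def)
    have "gcd b s dvd D"
      using pair(2) by (metis dvd_add_right_iff dvd_mult dvd_mult2 gcd_dvd1 gcd_dvd2)
    moreover have "coprime (gcd b s) m"
      using pair(3) by (rule coprime_divisors[OF gcd_dvd2 dvd_refl])
    ultimately show "?g x \<in> {k. k dvd D \<and> coprime k m}" using pair(1) by simp
  qed
  hence "card (det_pairs m n y z D)
      = (\<Sum>k | k dvd D \<and> coprime k m. card {x\<in>det_pairs m n y z D. ?g x = k})"
    using assms sum.group[of "det_pairs m n y z D" "{k. k dvd D \<and> coprime k m}" ?g "\<lambda>_. 1 :: nat"]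
    by simp
  also have "\<dots> = (\<Sum>k | k dvd D \<and> coprime k m.
      card (reduced_det_pairs m n (y / real k) (z / real k) (D div k)))"
  proof (intro sum.cong refl)
    fix k assume divisor: "k \<in> {k. k dvd D \<and> coprime k m}"
    hence "k > 0" using assms by (auto intro: Nat.gr0I)
    moreover have "{x\<in>det_pairs m n y z D. ?g x = k}
        = {(a, q, b, s). (a, q, b, s) \<in> det_pairs m n y z (k * (D div k)) \<and> gcd b s = k}"
      using divisor by auto
    ultimately show "card {x\<in>det_pairs m n y z D. ?g x = k}
        = card (reduced_det_pairs m n (y / real k) (z / real k) (D div k))"
      using divisor by (simp only: card_det_pairs_gcd_eq mem_Collect_eq)
  qed
  finally show ?thesis .
qed

definition relative_totient :: "nat \<Rightarrow> nat \<Rightarrow> real" where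
  "relative_totient m D = real (totient (m * D)) / real (totient m)"

lemma relative_totient_eq:
  assumes "m > 0"
  shows "relative_totient m D = real (totient D) * (real (gcd D m) / real (totient (gcd D m)))"
proof -
  have "real (totient (m * D)) * real (totient (gcd D m))
      = real (totient m) * real (totient D) * real (gcd D m)"
    using totient_gcd[of m D] by (simp add: gcd.commute flip: of_nat_mult)
  thus ?thesis using assms by (simp add: relative_totient_def field_simps)
qed

lemma card_coprime_multiple_range: "card {x\<in>{0<..D * m}. coprime x m} = D * totient m"
proof (induction D)
  case (Suc D)
  have shift: "coprime (D * m + x) m \<longleftrightarrow> coprime x m" for x
    by (metis coprime_iff_gcd_eq_1 gcd.commute gcd_add_mult)
  have "{x\<in>{0<..Suc D * m}. coprime x m}
      = {x\<in>{0<..D * m}. coprime x m} \<union> (\<lambda>x. D * m + x) ` totatives m"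
  proof (intro equalityI subsetI)
    fix x assume x_coprime: "x \<in> {x\<in>{0<..Suc D * m}. coprime x m}"
    show "x \<in> {x\<in>{0<..D * m}. coprime x m} \<union> (\<lambda>x. D * m + x) ` totatives m"
    proof (cases "x \<le> D * m")
      case False
      then obtain t where "x = D * m + t" "t > 0" by (metis less_imp_add_positive not_le)
      thus ?thesis using x_coprime by (auto simp: totatives_def shift)
    qed (use x_coprime in auto)
  qed (auto simp: totatives_def shift)
  also have "card \<dots> = D * totient m + card ((\<lambda>x. D * m + x) ` totatives m)"
    using Suc by (subst card_Un_disjoint) (auto simp: totatives_def)
  finally show ?case by (simp add: card_image totient_def)
qed auto

text \<open>Both sides, multiplied by \<open>totient m\<close>, count the \<open>x \<le> m D\<close> that are coprime to \<open>m\<close>; on the left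
  they are sorted by \<open>gcd x (m D)\<close>.\<close>

lemma sum_relative_totient:
  assumes "D > 0" "m > 0"
  shows "(\<Sum>k | k dvd D \<and> coprime k m. relative_totient m (D div k)) = real D"
proof -
  define A where "A = {x\<in>{0<..D * m}. coprime x m}"
  define K where "K = {k. k dvd D \<and> coprime k m}"
  have coprime_iff: "coprime x m \<longleftrightarrow> coprime (gcd x (D * m)) m" for x
    by (simp add: coprime_iff_gcd_eq_1 gcd.assoc)
  have "gcd x (D * m) \<in> K" if "x \<in> A" for x
  proof -
    have gcd_coprime: "coprime (gcd x (D * m)) m" using that coprime_iff by (simp add: A_def)
    moreover have "gcd x (D * m) dvd D"
      using coprime_dvd_mult_left_iff[OF gcd_coprime] gcd_dvd2 by blast
    ultimately show ?thesis by (simp add: K_def)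
  qed
  hence "card A = (\<Sum>k\<in>K. card {x\<in>A. gcd x (D * m) = k})"
    using assms(1) sum.group[of A K "\<lambda>x. gcd x (D * m)" "\<lambda>_. 1 :: nat"]
    by (simp add: A_def K_def image_subset_iff)
  also have "\<dots> = (\<Sum>k\<in>K. totient (m * (D div k)))"
  proof (intro sum.cong refl)
    fix k assume divisor: "k \<in> K"
    hence "{x\<in>A. gcd x (D * m) = k} = {x\<in>{0<..D * m}. gcd x (D * m) = k}"
      using coprime_iff by (auto simp: A_def K_def)
    also have "card \<dots> = totient (D * m div k)"
      using divisor assms by (intro card_gcd_eq_totient) (auto simp: K_def)
    also have "D * m div k = m * (D div k)" using divisor by (auto simp: K_def)
    finally show "card {x\<in>A. gcd x (D * m) = k} = totient (m * (D div k))" .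
  qed
  finally have "D * totient m = (\<Sum>k\<in>K. totient (m * (D div k)))"
    unfolding A_def card_coprime_multiple_range .
  hence "(\<Sum>k\<in>K. real (totient (m * (D div k)))) = real D * real (totient m)"
    by (simp flip: of_nat_sum of_nat_mult)
  thus ?thesis using assms by (simp add: relative_totient_def K_def flip: sum_divide_distrib)
qed

lemma sum_relative_totient_proper:
  assumes "D > 0" "m > 0"
  shows "(\<Sum>k\<in>{k. k dvd D \<and> coprime k m} - {1}. relative_totient m (D div k))
       = real D - relative_totient m D"
  using sum_relative_totient[OF assms] assms(1)
    sum.remove[of "{k. k dvd D \<and> coprime k m}" 1 "\<lambda>k. relative_totient m (D div k)"]
  by simp

lemma card_reduced_det_pairs_asymp:
  assumes "m > 0" "D > 0" "\<rho> > 0" "\<theta> > 0"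
  shows "(\<lambda>n. real (card (reduced_det_pairs m n (\<rho> * real n) (\<theta> * (real n)\<^sup>2) D)) / (real n)\<^sup>2)
     \<longlonglongrightarrow> totient_density m * C m * \<rho> * hyperbola_area (\<theta> / \<rho>) * (relative_totient m D / real D)"
  using assms(2-4)
proof (induction D arbitrary: \<rho> \<theta> rule: less_induct)
  case (less D)
  define \<kappa> where "\<kappa> = totient_density m * C m * \<rho> * hyperbola_area (\<theta> / \<rho>)"
  define Q where "Q n = real (card (det_pairs m n (\<rho> * real n) (\<theta> * (real n)\<^sup>2) D)) / (real n)\<^sup>2"
    for n
  define R where "R = (\<lambda>k n. real (card (reduced_det_pairs m n (\<rho> * real n / real k)
      (\<theta> * (real n)\<^sup>2 / real k) (D div k))) / (real n)\<^sup>2)"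
  define K where "K = {k. k dvd D \<and> coprime k m}"
  have K_props: "finite K" "1 \<in> K" using less.prems by (auto simp: K_def)
  have R_limit: "R k \<longlonglongrightarrow> \<kappa> * (relative_totient m (D div k) / real D)"
    if proper_divisor: "k \<in> K - {1}" for k
  proof -
    obtain l where D_eq: "D = k * l" using proper_divisor by (auto simp: K_def)
    have positive: "k > 0" "l > 0" using D_eq less.prems by (auto intro!: Nat.gr0I)
    hence "l < D" using proper_divisor D_eq by simp
    hence "(\<lambda>n. real (card (reduced_det_pairs m n (\<rho> / real k * real n)
          (\<theta> / real k * (real n)\<^sup>2) l)) / (real n)\<^sup>2)
        \<longlonglongrightarrow> totient_density m * C m * (\<rho> / real k) * hyperbola_area ((\<theta> / real k) / (\<rho> / real k))
              * (relative_totient m l / real l)"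
      using less.prems positive by (intro less.IH) auto
    thus ?thesis using positive by (simp add: R_def D_eq \<kappa>_def field_simps)
  qed
  have "Q n = (\<Sum>k\<in>K. R k n)" for n
    by (simp add: Q_def R_def card_det_pairs_eq_sum[OF less.prems(1)] K_def sum_divide_distrib)
  hence R_1_eq: "R 1 n = Q n - (\<Sum>k\<in>K - {1}. R k n)" for n
    by (simp add: sum.remove[OF K_props])
  have "(\<Sum>k\<in>K - {1}. relative_totient m (D div k)) = real D - relative_totient m D"
    unfolding K_def by (rule sum_relative_totient_proper[OF less.prems(1) assms(1)])
  hence "(\<Sum>k\<in>K - {1}. \<kappa> * (relative_totient m (D div k) / real D))
      = \<kappa> * ((real D - relative_totient m D) / real D)"
    by (simp flip: sum_distrib_left sum_divide_distrib)
  hence main_terms: "\<kappa> - (\<Sum>k\<in>K - {1}. \<kappa> * (relative_totient m (D div k) / real D))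
      = \<kappa> * (relative_totient m D / real D)"
    using less.prems(1) by (simp add: field_simps)
  have "(\<lambda>n. Q n - (\<Sum>k\<in>K - {1}. R k n))
      \<longlonglongrightarrow> \<kappa> - (\<Sum>k\<in>K - {1}. \<kappa> * (relative_totient m (D div k) / real D))"
    unfolding Q_def \<kappa>_def using assms(1) less.prems R_limit[unfolded \<kappa>_def]
    by (intro tendsto_diff tendsto_sum card_det_pairs_asymp) auto
  thus ?case unfolding main_terms R_1_eq[symmetric] by (simp add: R_def \<kappa>_def)
qed

section \<open>From initial intervals to all bounded intervals\<close>

lemma tendsto_squeeze_isCont:
  fixes g :: "real \<Rightarrow> real"
  assumes "a < x" "isCont g x"
    and lim: "\<And>y. y > a \<Longrightarrow> (p y \<longlongrightarrow> g y) F"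
    and lower: "\<And>y. a < y \<Longrightarrow> y < x \<Longrightarrow> \<forall>\<^sub>F n in F. p y n \<le> q n"
    and upper: "\<And>y. x < y \<Longrightarrow> \<forall>\<^sub>F n in F. q n \<le> p y n"
  shows "(q \<longlongrightarrow> g x) F"
proof (rule order_tendstoI)
  fix l assume "l < g x"
  hence "\<forall>\<^sub>F y in at_left x. l < g y"
    using assms(2) by (auto simp: isCont_def filterlim_at_split dest: order_tendstoD(1))
  moreover have "\<forall>\<^sub>F y in at_left x. y \<in> {a<..<x}" using assms(1) by (rule eventually_at_left_real)
  ultimately have "\<forall>\<^sub>F y in at_left x. l < g y \<and> y \<in> {a<..<x}" by (rule eventually_conj)
  then obtain y where y_near: "l < g y" "a < y" "y < x"
    using eventually_happens'[OF trivial_limit_at_left_real] by auto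
  have "\<forall>\<^sub>F n in F. l < p y n" using lim[of y] y_near by (intro order_tendstoD(1)) auto
  thus "\<forall>\<^sub>F n in F. l < q n" using lower[OF y_near(2,3)] by eventually_elim simp
next
  fix l assume "g x < l"
  hence "\<forall>\<^sub>F y in at_right x. g y < l"
    using assms(2) by (auto simp: isCont_def filterlim_at_split dest: order_tendstoD(2))
  moreover have "\<forall>\<^sub>F y in at_right x. y \<in> {x<..<x + 1}" by (rule eventually_at_right_real) simp
  ultimately have "\<forall>\<^sub>F y in at_right x. g y < l \<and> y \<in> {x<..<x + 1}" by (rule eventually_conj)
  then obtain y where y_near: "g y < l" "x < y"
    using eventually_happens'[OF trivial_limit_at_right_real] by auto
  have "\<forall>\<^sub>F n in F. p y n < l" using lim[of y] y_near assms(1) by (intro order_tendstoD(2)) auto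
  thus "\<forall>\<^sub>F n in F. q n < l" using upper[OF y_near(2)] by eventually_elim simp
qed

locale asymptotic_content =
  fixes \<mu> :: "nat \<Rightarrow> real set \<Rightarrow> real" and G :: "real \<Rightarrow> real"
  assumes nonneg: "\<mu> n I \<ge> 0"
    and reflect: "\<mu> n (uminus ` I) = \<mu> n I"
    and additive: "I \<inter> J = {} \<Longrightarrow> bounded (I \<union> J) \<Longrightarrow>
      \<forall>\<^sub>F n in sequentially. \<mu> n (I \<union> J) = \<mu> n I + \<mu> n J"
    and initial: "x \<ge> 0 \<Longrightarrow> (\<lambda>n. \<mu> n {0..x}) \<longlonglongrightarrow> G x"
    and G_zero: "G 0 = 0"
    and G_left: "x > 0 \<Longrightarrow> (G \<longlongrightarrow> G x) (at_left x)"
begin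

lemma tendsto_Un:
  assumes "(\<lambda>n. \<mu> n I) \<longlonglongrightarrow> a" "(\<lambda>n. \<mu> n J) \<longlonglongrightarrow> b" "I \<inter> J = {}" "bounded (I \<union> J)"
  shows "(\<lambda>n. \<mu> n (I \<union> J)) \<longlonglongrightarrow> a + b"
  using tendsto_add[OF assms(1,2)]
  by (rule Lim_transform_eventually) (use additive[OF assms(3,4)] in eventually_elim, simp)

lemma eventually_Diff:
  assumes "J \<subseteq> I" "bounded I"
  shows "\<forall>\<^sub>F n in sequentially. \<mu> n I - \<mu> n J = \<mu> n (I - J)"
proof -
  have "J \<union> (I - J) = I" using assms(1) by blast
  thus ?thesis using additive[of J "I - J"] assms(2) by (auto elim: eventually_mono)
qed

lemma tendsto_Diff:
  assumes "(\<lambda>n. \<mu> n I) \<longlonglongrightarrow> a" "(\<lambda>n. \<mu> n J) \<longlonglongrightarrow> b" "J \<subseteq> I" "bounded I"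
  shows "(\<lambda>n. \<mu> n (I - J)) \<longlonglongrightarrow> a - b"
  using tendsto_diff[OF assms(1,2)] eventually_Diff[OF assms(3,4)]
  by (rule Lim_transform_eventually)

lemma eventually_subset_le:
  assumes "J \<subseteq> I" "bounded I"
  shows "\<forall>\<^sub>F n in sequentially. \<mu> n J \<le> \<mu> n I"
  using eventually_Diff[OF assms] by eventually_elim (metis diff_ge_0_iff_ge nonneg)

lemma tendsto_singleton: "(\<lambda>n. \<mu> n {a}) \<longlonglongrightarrow> 0"
proof -
  have positive_case: "(\<lambda>n. \<mu> n {a}) \<longlonglongrightarrow> 0" if a_pos: "a > 0" for a
  proof (rule order_tendstoI)
    fix u :: real assume "u > 0"
    hence "\<forall>\<^sub>F y in at_left a. G a - u < G y"
      using G_left[OF a_pos] by (intro order_tendstoD(1)) auto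
    moreover have "\<forall>\<^sub>F y in at_left a. y \<in> {0<..<a}" using a_pos by (rule eventually_at_left_real)
    ultimately have "\<forall>\<^sub>F y in at_left a. G a - u < G y \<and> y \<in> {0<..<a}" by (rule eventually_conj)
    then obtain y where y_near: "G a - G y < u" "0 < y" "y < a"
      using eventually_happens'[OF trivial_limit_at_left_real] by (auto simp: algebra_simps)
    have "(\<lambda>n. \<mu> n ({0..a} - {0..y})) \<longlonglongrightarrow> G a - G y"
      using a_pos y_near by (intro tendsto_Diff initial) auto
    hence "\<forall>\<^sub>F n in sequentially. \<mu> n ({0..a} - {0..y}) < u"
      using y_near(1) by (rule order_tendstoD(2))
    moreover have "\<forall>\<^sub>F n in sequentially. \<mu> n {a} \<le> \<mu> n ({0..a} - {0..y})"
      using a_pos y_near by (intro eventually_subset_le) auto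
    ultimately show "\<forall>\<^sub>F n in sequentially. \<mu> n {a} < u" by eventually_elim simp
  qed (use nonneg in \<open>auto intro: always_eventually less_le_trans\<close>)
  consider (pos) "a > 0" | (zero) "a = 0" | (neg) "-a > 0" by linarith
  thus ?thesis
  proof cases
    case zero
    thus ?thesis using initial[of 0] G_zero by simp
  next
    case neg
    thus ?thesis using positive_case[of "-a"] reflect[of _ "{a}"] by simp
  qed (rule positive_case)
qed

lemma tendsto_finite:
  assumes "finite A"
  shows "(\<lambda>n. \<mu> n A) \<longlonglongrightarrow> 0"
  using assms
proof (induction A)
  case empty
  show ?case using tendsto_Diff[OF tendsto_singleton tendsto_singleton, of 0 0] by simp
next
  case (insert a A)
  thus ?case
    using tendsto_Un[OF tendsto_singleton[of a] insert.IH] by (simp add: finite_imp_bounded)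
qed

lemma tendsto_almost_eq:
  assumes "(\<lambda>n. \<mu> n I) \<longlonglongrightarrow> l" "bounded I" "finite (I - J)" "finite (J - I)"
  shows "(\<lambda>n. \<mu> n J) \<longlonglongrightarrow> l"
proof -
  have "(\<lambda>n. \<mu> n (I - (I - J))) \<longlonglongrightarrow> l - 0"
    using assms by (intro tendsto_Diff tendsto_finite) auto
  hence "(\<lambda>n. \<mu> n ((I - (I - J)) \<union> (J - I))) \<longlonglongrightarrow> l - 0 + 0"
    using assms by (intro tendsto_Un tendsto_finite) (auto intro: finite_imp_bounded bounded_subset)
  moreover have "(I - (I - J)) \<union> (J - I) = J" by blast
  ultimately show ?thesis by simp
qed

lemma tendsto_Icc_nonneg:
  assumes "0 \<le> a" "a \<le> b"
  shows "(\<lambda>n. \<mu> n {a..b}) \<longlonglongrightarrow> G b - G a"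
proof (rule tendsto_almost_eq)
  show "(\<lambda>n. \<mu> n ({0..b} - {0..a})) \<longlonglongrightarrow> G b - G a"
    using assms by (intro tendsto_Diff initial) auto
  have "{a..b} - ({0..b} - {0..a}) \<subseteq> {a}" using assms by auto
  thus "finite ({a..b} - ({0..b} - {0..a}))" by (rule finite_subset) simp
  have "({0..b} - {0..a}) - {a..b} \<subseteq> {}" by auto
  thus "finite (({0..b} - {0..a}) - {a..b})" by (rule finite_subset) simp
qed (auto intro: bounded_subset)

lemma tendsto_Icc_nonpos:
  assumes "a \<le> b" "b \<le> 0"
  shows "(\<lambda>n. \<mu> n {a..b}) \<longlonglongrightarrow> G (-a) - G (-b)"
  using tendsto_Icc_nonneg[of "-b" "-a"] reflect[of _ "{a..b}"] assms by simp

lemma convergent_Icc: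
  assumes "a \<le> b"
  shows "convergent (\<lambda>n. \<mu> n {a..b})"
proof -
  consider (nonneg) "0 \<le> a" | (nonpos) "b \<le> 0" | (straddling) "a < 0" "0 < b" by linarith
  thus ?thesis
  proof cases
    case straddling
    have "(\<lambda>n. \<mu> n ({a..0} - {0})) \<longlonglongrightarrow> G (-a) - G (-0) - 0"
      using straddling by (intro tendsto_Diff tendsto_Icc_nonpos tendsto_finite) auto
    hence "(\<lambda>n. \<mu> n (({a..0} - {0}) \<union> {0..b})) \<longlonglongrightarrow> G (-a) - G (-0) - 0 + (G b - G 0)"
      using straddling by (intro tendsto_Un tendsto_Icc_nonneg) (auto intro: bounded_subset)
    moreover have "({a..0} - {0}) \<union> {0..b} = {a..b}" using straddling by auto
    ultimately show ?thesis by (metis convergentI)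
  qed (use assms in \<open>blast intro: convergentI tendsto_Icc_nonneg tendsto_Icc_nonpos\<close>)+
qed

lemma convergent_bounded_interval:
  assumes "is_interval I" "bounded I"
  shows "convergent (\<lambda>n. \<mu> n I)"
proof (cases "I = {}")
  case True
  thus ?thesis using tendsto_finite by (auto intro: convergentI)
next
  case False
  define a b where "a = Inf I" and "b = Sup I"
  have bdd_I: "bdd_above I" "bdd_below I"
    using assms(2) by (auto simp: bounded_imp_bdd_above bounded_imp_bdd_below)
  have I_subset: "I \<subseteq> {a..b}"
    using bdd_I by (auto simp: a_def b_def intro: cInf_lower cSup_upper)
  have subset_I: "{a<..<b} \<subseteq> I"
  proof
    fix x assume x_between: "x \<in> {a<..<b}"
    obtain y where left: "y \<in> I" "y < x"
      using x_between False bdd_I cInf_less_iff[of I x] by (auto simp: a_def)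
    obtain z where right: "z \<in> I" "x < z"
      using x_between False bdd_I less_cSup_iff[of I x] by (auto simp: b_def)
    show "x \<in> I" using assms(1) left right unfolding is_interval_1 by (meson less_imp_le)
  qed
  have "{a..b} \<noteq> {}" using False I_subset by blast
  hence "a \<le> b" by simp
  then obtain l where "(\<lambda>n. \<mu> n {a..b}) \<longlonglongrightarrow> l"
    using convergent_Icc unfolding convergent_def by blast
  moreover have "{a..b} - I \<subseteq> {a..b} - {a<..<b}" using subset_I by blast
  hence "{a..b} - I \<subseteq> {a, b}" by auto
  hence "finite ({a..b} - I)" by (rule finite_subset) simp
  moreover have "finite (I - {a..b})" using I_subset by (metis Diff_eq_empty_iff finite.emptyI)
  ultimately have "(\<lambda>n. \<mu> n I) \<longlonglongrightarrow> l" by (intro tendsto_almost_eq[of "{a..b}" l I]) simp_all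
  thus ?thesis by (rule convergentI)
qed

end

section \<open>Pairs of points at a given distance modulo 1\<close>

definition close_pairs :: "real set \<Rightarrow> real set \<Rightarrow> (real \<times> real) set" where
  "close_pairs F I = {(x, y). x \<in> F \<and> y \<in> F \<and> y \<noteq> x \<and>
     (\<exists>t\<in>I. \<exists>k::int. y - x = 1 / real (card F) * t + of_int k)}"

lemma pair_corr_eq: "pair_corr F I = real (card (close_pairs F I)) / real (card F)"
  by (simp add: pair_corr_def close_pairs_def)

lemma finite_close_pairs: "finite F \<Longrightarrow> finite (close_pairs F I)"
  by (rule finite_subset[of _ "F \<times> F"]) (auto simp: close_pairs_def)

lemma swap_in_close_pairs_uminus:
  assumes "z \<in> close_pairs F I"
  shows "prod.swap z \<in> close_pairs F (uminus ` I)"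
proof -
  obtain x y t k where pair: "z = (x, y)" "x \<in> F" "y \<in> F" "y \<noteq> x" "t \<in> I"
    and diff_eq: "y - x = 1 / real (card F) * t + of_int k"
    using assms by (auto simp: close_pairs_def)
  have "x - y = 1 / real (card F) * (-t) + of_int (-k)" using diff_eq by simp
  hence "\<exists>t\<in>uminus ` I. \<exists>k::int. x - y = 1 / real (card F) * t + of_int k" using pair(5) by blast
  thus ?thesis using pair(1-4) by (simp add: close_pairs_def)
qed

lemma pair_corr_uminus: "pair_corr F (uminus ` I) = pair_corr F I"
proof -
  have "bij_betw prod.swap (close_pairs F I) (close_pairs F (uminus ` I))"
    using swap_in_close_pairs_uminus[of _ F I] swap_in_close_pairs_uminus[of _ F "uminus ` I"]
    by (intro bij_betw_byWitness[of _ prod.swap]) (auto simp: image_image)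
  thus ?thesis by (simp add: pair_corr_eq bij_betw_same_card)
qed

lemma pair_corr_mono:
  assumes "finite F" "I \<subseteq> J"
  shows "pair_corr F I \<le> pair_corr F J"
proof -
  have "close_pairs F I \<subseteq> close_pairs F J" using assms(2) by (auto simp: close_pairs_def)
  hence "card (close_pairs F I) \<le> card (close_pairs F J)"
    using assms(1) by (intro card_mono finite_close_pairs)
  thus ?thesis by (simp add: pair_corr_eq divide_right_mono)
qed

lemma close_pairs_disjoint:
  assumes "finite F" "I \<inter> J = {}" "\<And>t t'. t \<in> I \<Longrightarrow> t' \<in> J \<Longrightarrow> \<bar>t - t'\<bar> < real (card F)"
  shows "close_pairs F I \<inter> close_pairs F J = {}"
proof (rule ccontr)
  assume "close_pairs F I \<inter> close_pairs F J \<noteq> {}"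
  then obtain x y t k t' k' where common: "t \<in> I" "t' \<in> J" "x \<in> F"
    "y - x = 1 / real (card F) * t + of_int k" "y - x = 1 / real (card F) * t' + of_int k'"
    by (auto simp: close_pairs_def) blast
  have card_pos: "real (card F) > 0" using common(3) assms(1) by (auto simp: card_gt_0_iff)
  have diff_eq: "t - t' = real (card F) * of_int (k' - k)"
    using common(4,5) card_pos by (simp add: field_simps)
  hence "real (card F) * \<bar>of_int (k' - k)\<bar> < real (card F) * 1"
    using assms(3)[OF common(1,2)] card_pos by (simp add: abs_mult)
  hence "k' = k" using card_pos by (simp only: mult_less_cancel_left_pos)
  thus False using diff_eq common(1,2) assms(2) by auto
qed

lemma pair_corr_Un:
  assumes "finite F" "I \<inter> J = {}" "\<And>t t'. t \<in> I \<Longrightarrow> t' \<in> J \<Longrightarrow> \<bar>t - t'\<bar> < real (card F)"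
  shows "pair_corr F (I \<union> J) = pair_corr F I + pair_corr F J"
proof -
  have "close_pairs F (I \<union> J) = close_pairs F I \<union> close_pairs F J" by (auto simp: close_pairs_def)
  thus ?thesis
    using assms
    by (simp add: pair_corr_eq card_Un_disjoint finite_close_pairs close_pairs_disjoint
        add_divide_distrib)
qed

lemma eventually_pair_corr_Un:
  assumes "\<And>n. finite (F n)" "filterlim (\<lambda>n. real (card (F n))) at_top sequentially"
    "I \<inter> J = {}" "bounded (I \<union> J)"
  shows "\<forall>\<^sub>F n in sequentially. pair_corr (F n) (I \<union> J) = pair_corr (F n) I + pair_corr (F n) J"
proof -
  obtain L where L_bound: "\<And>t. t \<in> I \<union> J \<Longrightarrow> \<bar>t\<bar> \<le> L" using assms(4) by (auto simp: bounded_iff)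
  have "\<forall>\<^sub>F n in sequentially. 2 * L < real (card (F n))"
    using assms(2) by (simp add: filterlim_at_top_dense)
  thus ?thesis
  proof eventually_elim
    case (elim n)
    have "\<bar>t - t'\<bar> < real (card (F n))" if "t \<in> I" "t' \<in> J" for t t'
      using L_bound[of t] L_bound[of t'] that elim by auto
    thus ?case by (intro pair_corr_Un assms)
  qed
qed

lemma pair_corr_singleton_0:
  assumes "F \<subseteq> {0<..1}"
  shows "pair_corr F {0} = 0"
proof -
  have "y = x" if "x \<in> F" "y \<in> F" "y - x = of_int k" for x y and k :: int
  proof -
    have "0 < x" "x \<le> 1" "0 < y" "y \<le> 1" using that assms by auto
    hence "-1 < real_of_int k" "real_of_int k < 1" using that(3) by linarith+
    hence "k = 0" by linarith
    thus ?thesis using that(3) by simp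
  qed
  hence "close_pairs F {0} = {}" by (auto simp: close_pairs_def)
  thus ?thesis by (simp add: pair_corr_eq)
qed

text \<open>For \<open>F \<subseteq> {0<..1}\<close> and \<open>\<delta> \<le> 1\<close>, \<open>z\<close> is the representative in \<open>(x, x + 1)\<close> of an element of
  \<open>F + \<int>\<close>.\<close>

definition gap_pairs :: "real set \<Rightarrow> real \<Rightarrow> (real \<times> real) set" where
  "gap_pairs F \<delta> = {(x, z). x \<in> F \<and> (z \<in> F \<or> z - 1 \<in> F) \<and> x < z \<and> z < x + \<delta>}"

lemma in_close_pairs_iff:
  assumes "finite F" "F \<subseteq> {0<..1}" "0 < \<delta>" "\<delta> \<le> 1"
  shows "(x, y) \<in> close_pairs F {0..<real (card F) * \<delta>}
     \<longleftrightarrow> x \<in> F \<and> y \<in> F \<and> (x < y \<and> y < x + \<delta> \<or> y + 1 < x + \<delta>)"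
    (is "?lhs \<longleftrightarrow> ?rhs")
proof
  assume ?lhs
  then obtain t k where points: "x \<in> F" "y \<in> F" "y \<noteq> x" and t_range: "t \<in> {0..<real (card F) * \<delta>}"
    and diff_eq: "y - x = 1 / real (card F) * t + of_int k"
    by (auto simp: close_pairs_def)
  have bounds: "0 < x" "x \<le> 1" "0 < y" "y \<le> 1" using points assms(2) by auto
  have "real (card F) > 0" using points assms(1) by (auto simp: card_gt_0_iff)
  hence distance: "0 \<le> 1 / real (card F) * t" "1 / real (card F) * t < \<delta>"
    using t_range by (auto simp: field_simps)
  hence "real_of_int k < 1" "real_of_int k > -2" using diff_eq bounds assms(4) by linarith+
  hence "k = 0 \<or> k = -1" by linarith
  thus ?rhs using points distance diff_eq by auto
next
  assume rhs: ?rhs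
  hence card_pos: "real (card F) > 0" using assms(1) by (auto simp: card_gt_0_iff)
  have bounds: "0 < x" "x \<le> 1" "0 < y" "y \<le> 1" using rhs assms(2) by auto
  from rhs obtain k :: int where shift: "0 < y - x - of_int k" "y - x - of_int k < \<delta>" "y \<noteq> x"
  proof (elim conjE disjE)
    assume "y + 1 < x + \<delta>"
    thus ?thesis using that[of "-1"] bounds assms(4) by auto
  qed (use that[of 0] in auto)
  define t where "t = real (card F) * (y - x - of_int k)"
  have "t \<in> {0..<real (card F) * \<delta>}" "y - x = 1 / real (card F) * t + of_int k"
    using shift card_pos by (simp_all add: t_def)
  thus ?lhs using rhs shift(3) unfolding close_pairs_def by blast
qed

lemma inj_on_lift_right:
  fixes F :: "real set"
  assumes "F \<subseteq> {0<..1}"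
  shows "inj_on (\<lambda>(x, y). (x, if x < y then y else y + 1)) (F \<times> F)"
proof -
  have "y \<noteq> y' + 1" if "y \<in> F" "y' \<in> F" for y y'
  proof -
    have "y \<le> 1" "0 < y'" using that assms by auto
    thus ?thesis by simp
  qed
  thus ?thesis by (fastforce simp: inj_on_def split: if_splits)
qed

lemma card_close_pairs_eq_gap_pairs:
  assumes "finite F" "F \<subseteq> {0<..1}" "0 < \<delta>" "\<delta> \<le> 1"
  shows "card (close_pairs F {0..<real (card F) * \<delta>}) = card (gap_pairs F \<delta>)"
proof -
  let ?lift = "\<lambda>(x, y). (x, if x < y then y else y + 1)"
  have bounds: "0 < x" "x \<le> 1" if "x \<in> F" for x using that assms(2) by auto
  note close_iff = in_close_pairs_iff[OF assms]
  have inj: "inj_on ?lift (close_pairs F {0..<real (card F) * \<delta>})"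
    by (rule inj_on_subset[OF inj_on_lift_right[OF assms(2)]]) (auto simp: close_pairs_def)
  have "?lift ` close_pairs F {0..<real (card F) * \<delta>} = gap_pairs F \<delta>"
  proof (intro equalityI subsetI)
    fix u assume "u \<in> ?lift ` close_pairs F {0..<real (card F) * \<delta>}"
    then obtain x y where u_pair: "u = (x, if x < y then y else y + 1)"
      and close: "(x, y) \<in> close_pairs F {0..<real (card F) * \<delta>}"
      by auto
    have "x \<le> 1" "0 < y" using close bounds by (auto simp: close_iff)
    thus "u \<in> gap_pairs F \<delta>" using u_pair close by (auto simp: close_iff gap_pairs_def)
  next
    fix u assume "u \<in> gap_pairs F \<delta>"
    then obtain x z where u_pair: "u = (x, z)" "x \<in> F" "x < z" "z < x + \<delta>"
      and z_lift: "z \<in> F \<or> z - 1 \<in> F"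
      by (auto simp: gap_pairs_def)
    from z_lift show "u \<in> ?lift ` close_pairs F {0..<real (card F) * \<delta>}"
    proof
      assume "z \<in> F"
      thus ?thesis using u_pair by (intro image_eqI[of _ _ "(x, z)"]) (auto simp: close_iff)
    next
      assume "z - 1 \<in> F"
      moreover have "\<not> x < z - 1" using u_pair(4) assms(4) by simp
      ultimately show ?thesis
        using u_pair by (intro image_eqI[of _ _ "(x, z - 1)"]) (auto simp: close_iff)
    qed
  qed
  with card_image[OF inj] show ?thesis by simp
qed

section \<open>Pair correlation of the Farey fractions\<close>

lemma farey_coprimeI:
  "0 < a \<Longrightarrow> a \<le> q \<Longrightarrow> q \<le> n \<Longrightarrow> coprime a q \<Longrightarrow> coprime q m \<Longrightarrow>
    real a / real q \<in> farey_coprime m n"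
  unfolding farey_coprime_def by blast

lemma farey_coprimeE:
  assumes "x \<in> farey_coprime m n"
  obtains a q where "x = real a / real q" "q \<in> {1..n}" "a \<in> totatives q" "coprime q m"
  using assms by (force simp: farey_coprime_def totatives_def)

lemma farey_coprime_subset: "farey_coprime m n \<subseteq> {0<..1}"
  by (auto simp: farey_coprime_def)

lemma incseq_farey_coprime: "incseq (farey_coprime m)"
  unfolding incseq_def farey_coprime_def by (auto intro: order_trans)

lemma farey_coprime_eq_image:
  "farey_coprime m n = (\<lambda>(q, a). real a / real q) ` (SIGMA q:{q\<in>{1..n}. coprime q m}. totatives q)"
  by (force simp: farey_coprime_def totatives_def image_iff)

lemma finite_farey_coprime: "finite (farey_coprime m n)"
  unfolding farey_coprime_eq_image by (intro finite_imageI finite_SigmaI) auto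

lemma reduced_fraction_eq:
  fixes a q b s :: nat
  assumes "q > 0" "s > 0" "coprime a q" "coprime b s" "real a / real q = real b / real s"
  shows "a = b \<and> q = s"
proof -
  have "real a * real s = real b * real q" using assms by (simp add: field_simps)
  hence "a * s = b * q" by (metis of_nat_eq_iff of_nat_mult)
  thus ?thesis using assms(3,4) coprime_crossproduct_nat[of a q b s]
    by (auto simp: mult.commute coprime_commute)
qed

lemma card_farey_coprime:
  "card (farey_coprime m n) = (\<Sum>q | q \<in> {1..n} \<and> coprime q m. totient q)"
proof -
  have "inj_on (\<lambda>(q, a). real a / real q) (SIGMA q:{q\<in>{1..n}. coprime q m}. totatives q)"
  proof (rule inj_onI, clarify)
    fix q a s b assume "q \<in> {1..n}" "s \<in> {1..n}" "a \<in> totatives q" "b \<in> totatives s"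
      "real a / real q = real b / real s"
    thus "q = s \<and> a = b" using reduced_fraction_eq[of q s a b] by (auto simp: totatives_def)
  qed
  thus ?thesis
    unfolding farey_coprime_eq_image by (simp add: card_image card_SigmaI totient_def)
qed

lemma card_farey_coprime_asymp:
  assumes "m > 0"
  shows "(\<lambda>n. real (card (farey_coprime m n)) / (real n)\<^sup>2) \<longlonglongrightarrow> C m / 2"
proof -
  have "(\<lambda>n. (\<Sum>q\<in>{1..n}. coprime_totient_density m q * (real q / real n)) / real n)
      \<longlonglongrightarrow> C m * integral {0..1} (\<lambda>t. t)"
    using assms
    by (intro weighted_riemann_sum mean_coprime_totient_density coprime_totient_density_nonneg)
      (auto intro: continuous_intros)
  moreover have "(\<Sum>q\<in>{1..n}. coprime_totient_density m q * (real q / real n)) / real n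
      = real (card (farey_coprime m n)) / (real n)\<^sup>2" for n
  proof -
    have "real (card (farey_coprime m n)) = (\<Sum>q\<in>{1..n}. coprime_totient_density m q * real q)"
      unfolding card_farey_coprime of_nat_sum
      by (rule sum.mono_neutral_cong_left)
         (auto simp: coprime_totient_density_def totient_density_def)
    thus ?thesis by (simp add: sum_divide_distrib power2_eq_square)
  qed
  moreover have "integral {0..1} (\<lambda>t::real. t) = 1 / 2"
    using ident_has_integral[of 0 "1::real"] by (simp add: integral_unique)
  ultimately show ?thesis by simp
qed

lemma filterlim_card_farey_coprime:
  assumes "m > 0"
  shows "filterlim (\<lambda>n. real (card (farey_coprime m n))) at_top sequentially"
proof -
  define N where "N = (\<lambda>n. real (card (farey_coprime m n)))"
  have "filterlim (\<lambda>n. N n / (real n)\<^sup>2 * (real n)\<^sup>2) at_top sequentially"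
    unfolding N_def using C_pos[OF assms] filterlim_real_sequentially
    by (intro filterlim_tendsto_pos_mult_at_top[OF card_farey_coprime_asymp[OF assms]]
          filterlim_pow_at_top) auto
  moreover have "\<forall>\<^sub>F n in sequentially. N n / (real n)\<^sup>2 * (real n)\<^sup>2 = N n"
    using eventually_gt_at_top[of 0] by eventually_elim simp
  ultimately show ?thesis
    unfolding N_def by (auto elim: filterlim_mono_eventually)
qed

lemma farey_coprime_lift_iff:
  "z \<in> farey_coprime m n \<or> z - 1 \<in> farey_coprime m n \<longleftrightarrow>
     (\<exists>b s. z = real b / real s \<and> 0 < b \<and> b \<le> 2 * s \<and> s \<le> n \<and> coprime b s \<and> coprime s m)"
    (is "?lhs \<longleftrightarrow> ?rhs")
proof
  assume ?lhs
  thus ?rhs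
  proof
    assume "z \<in> farey_coprime m n"
    thus ?rhs unfolding farey_coprime_def by fastforce
  next
    assume "z - 1 \<in> farey_coprime m n"
    then obtain b s
      where "z - 1 = real b / real s" "0 < b" "b \<le> s" "s \<le> n" "coprime b s" "coprime s m"
      by (auto simp: farey_coprime_def)
    hence "z = real (b + s) / real s" "0 < b + s" "b + s \<le> 2 * s" "coprime (b + s) s"
      by (auto simp: field_simps coprime_iff_gcd_eq_1)
    thus ?rhs using \<open>s \<le> n\<close> \<open>coprime s m\<close> by blast
  qed
next
  assume ?rhs
  then obtain b s
    where fraction: "z = real b / real s" "0 < b" "b \<le> 2 * s" "s \<le> n" "coprime b s" "coprime s m"
    by blast
  show ?lhs
  proof (cases "b \<le> s")
    case True
    thus ?thesis using fraction farey_coprimeI by blast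
  next
    case False
    hence "z - 1 = real (b - s) / real s" using fraction by (simp add: of_nat_diff field_simps)
    moreover have "coprime (b - s) s"
      using fraction(5) False by (simp add: coprime_iff_gcd_eq_1 gcd_diff1_nat)
    ultimately show ?thesis using fraction False farey_coprimeI[of "b - s" s n m] by auto
  qed
qed

lemma fraction_diff_eq:
  fixes a q b s D :: nat
  assumes "q > 0" "s > 0" "b * q = a * s + D"
  shows "real b / real s - real a / real q = real D / (real q * real s)"
proof -
  have "real b * real q = real a * real s + real D" using assms(3) by (metis of_nat_add of_nat_mult)
  thus ?thesis using assms(1,2) by (simp add: field_simps)
qed

lemma fraction_less_add_iff:
  fixes a q b s D :: nat
  assumes "q > 0" "s > 0" "b * q = a * s + D" "c > 0" "t > 0"
  shows "real b / real s < real a / real q + c / t \<longleftrightarrow> real D / c * t < real q * real s"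
proof -
  have "real b / real s < real a / real q + c / t \<longleftrightarrow> real D / (real q * real s) < c / t"
    using fraction_diff_eq[OF assms(1-3)] by linarith
  thus ?thesis using assms by (simp add: field_simps)
qed

definition neighbour_fractions :: "nat \<Rightarrow> nat \<Rightarrow> real \<Rightarrow> (nat \<times> nat \<times> nat \<times> nat) set" where
  "neighbour_fractions m n c =
     (\<Union>D\<in>nats_between 0 c. reduced_det_pairs m n (real n) (real D / c * (real n)\<^sup>2) D)"

lemma card_neighbour_fractions:
  "card (neighbour_fractions m n c)
     = (\<Sum>D\<in>nats_between 0 c. card (reduced_det_pairs m n (real n) (real D / c * (real n)\<^sup>2) D))"
  unfolding neighbour_fractions_def
proof (rule card_UN_disjoint)
  show "\<forall>D\<in>nats_between 0 c. \<forall>D'\<in>nats_between 0 c. D \<noteq> D' \<longrightarrow>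
      reduced_det_pairs m n (real n) (real D / c * (real n)\<^sup>2) D
        \<inter> reduced_det_pairs m n (real n) (real D' / c * (real n)\<^sup>2) D' = {}"
    by (auto simp: reduced_det_pairs_def det_pairs_def)
qed auto

text \<open>Only determinants \<open>D < c\<close> can occur, because \<open>q s \<le> n\<^sup>2\<close>.\<close>

lemma in_neighbour_fractions_iff:
  assumes "n > 0" "c > 0"
  shows "(a, q, b, s) \<in> neighbour_fractions m n c \<longleftrightarrow>
     q \<in> {1..n} \<and> a \<in> totatives q \<and> coprime q m \<and> s \<in> {1..n} \<and> coprime b s \<and> coprime s m \<and>
     real a / real q < real b / real s \<and> real b / real s < real a / real q + c / (real n)\<^sup>2"
    (is "?lhs \<longleftrightarrow> ?rhs")
proof
  assume ?lhs
  then obtain D where determinant: "D > 0" "b * q = a * s + D"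
      "real D / c * (real n)\<^sup>2 < real q * real s"
    and reduced: "q \<in> {1..n}" "a \<in> totatives q" "coprime q m" "s \<le> n" "coprime b s" "coprime s m"
    by (auto simp: neighbour_fractions_def reduced_det_pairs_def det_pairs_def nats_between_def)
  have "0 \<le> real D / c * (real n)\<^sup>2" using assms by simp
  hence "0 < real q * real s" using determinant(3) by linarith
  hence "s > 0" by (simp add: zero_less_mult_iff)
  moreover have "real D / (real q * real s) > 0" using determinant(1) reduced(1) \<open>s > 0\<close> by simp
  ultimately show ?rhs
    using determinant(3) reduced assms fraction_diff_eq[OF _ _ determinant(2)]
    by (auto simp: fraction_less_add_iff[OF _ _ determinant(2)])
next
  assume ?rhs
  hence reduced: "q \<in> {1..n}" "a \<in> totatives q" "coprime q m"
      "s \<in> {1..n}" "coprime b s" "coprime s m"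
    and less: "real a / real q < real b / real s"
    and close: "real b / real s < real a / real q + c / (real n)\<^sup>2"
    by auto
  have "real a * real s < real b * real q" using less reduced by (simp add: field_simps)
  hence "a * s < b * q" by (metis of_nat_less_iff of_nat_mult)
  then obtain D where determinant: "b * q = a * s + D" "D > 0"
    using less_imp_add_positive by metis
  have bound: "real D / c * (real n)\<^sup>2 < real q * real s"
    using close fraction_less_add_iff[OF _ _ determinant(1), of c "(real n)\<^sup>2"] reduced assms by auto
  also have "\<dots> \<le> (real n)\<^sup>2" using reduced by (simp add: power2_eq_square mult_mono)
  finally have "real D < c" using assms by (simp add: field_simps)
  hence "D \<in> nats_between 0 c" using determinant(2) by (simp add: nats_between_def)
  thus ?lhs using reduced determinant(1) bound
    by (auto simp: neighbour_fractions_def reduced_det_pairs_def det_pairs_def)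
qed

lemma fraction_pair_in_gap_pairs:
  assumes "n > 0" "c > 0" "c \<le> (real n)\<^sup>2" "(a, q, b, s) \<in> neighbour_fractions m n c"
  shows "(real a / real q, real b / real s) \<in> gap_pairs (farey_coprime m n) (c / (real n)\<^sup>2)"
proof -
  have reduced: "q \<in> {1..n}" "a \<in> totatives q" "coprime q m"
      "s \<in> {1..n}" "coprime b s" "coprime s m"
    and close: "real a / real q < real b / real s"
      "real b / real s < real a / real q + c / (real n)\<^sup>2"
    using assms(4) by (auto simp: in_neighbour_fractions_iff[OF assms(1,2)])
  have first: "real a / real q \<in> farey_coprime m n"
    using reduced by (intro farey_coprimeI) (auto simp: totatives_def)
  hence "real a / real q \<in> {0<..1}" using farey_coprime_subset by blast
  moreover have "c / (real n)\<^sup>2 \<le> 1" using assms by simp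
  ultimately have "0 < real b / real s" "real b / real s < 2" using close by auto
  hence "0 < b" "b \<le> 2 * s" using reduced(4) by (auto simp: zero_less_divide_iff divide_less_eq)
  hence "real b / real s \<in> farey_coprime m n \<or> real b / real s - 1 \<in> farey_coprime m n"
    using reduced unfolding farey_coprime_lift_iff by auto
  thus ?thesis using first close by (simp add: gap_pairs_def)
qed

lemma inj_on_fraction_pair:
  assumes "n > 0" "c > 0"
  shows "inj_on (\<lambda>(a, q, b, s). (real a / real q, real b / real s)) (neighbour_fractions m n c)"
proof (rule inj_onI)
  let ?f = "\<lambda>(a, q, b, s). (real a / real q, real b / real s)"
  fix u v assume members: "u \<in> neighbour_fractions m n c" "v \<in> neighbour_fractions m n c"
    and values_eq: "?f u = ?f v"
  obtain a q b s a' q' b' s' where coordinates: "u = (a, q, b, s)" "v = (a', q', b', s')"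
    by (metis prod_cases4)
  note reduced = members[unfolded coordinates in_neighbour_fractions_iff[OF assms]]
  have "a = a' \<and> q = q'"
    by (rule reduced_fraction_eq) (use reduced values_eq in \<open>auto simp: coordinates totatives_def\<close>)
  moreover have "b = b' \<and> s = s'"
    by (rule reduced_fraction_eq) (use reduced values_eq in \<open>auto simp: coordinates\<close>)
  ultimately show "u = v" by (simp add: coordinates)
qed

lemma card_gap_pairs_farey_coprime:
  assumes "n > 0" "c > 0" "c \<le> (real n)\<^sup>2"
  shows "card (gap_pairs (farey_coprime m n) (c / (real n)\<^sup>2)) = card (neighbour_fractions m n c)"
proof -
  let ?f = "\<lambda>(a, q, b, s). (real a / real q, real b / real s)"
  have "?f ` neighbour_fractions m n c = gap_pairs (farey_coprime m n) (c / (real n)\<^sup>2)"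
  proof (intro equalityI subsetI)
    fix u assume "u \<in> gap_pairs (farey_coprime m n) (c / (real n)\<^sup>2)"
    then obtain x z where pair: "u = (x, z)" "x < z" "z < x + c / (real n)\<^sup>2"
      and "x \<in> farey_coprime m n" "z \<in> farey_coprime m n \<or> z - 1 \<in> farey_coprime m n"
      by (auto simp: gap_pairs_def)
    then obtain a q b s where "x = real a / real q" "q \<in> {1..n}" "a \<in> totatives q" "coprime q m"
      "z = real b / real s" "0 < b" "b \<le> 2 * s" "s \<le> n" "coprime b s" "coprime s m"
      unfolding farey_coprime_lift_iff by (elim farey_coprimeE) blast
    hence "(a, q, b, s) \<in> neighbour_fractions m n c" "u = ?f (a, q, b, s)"
      using pair by (auto simp: in_neighbour_fractions_iff[OF assms(1,2)])
    thus "u \<in> ?f ` neighbour_fractions m n c" by (rule image_eqI[rotated])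
  qed (use fraction_pair_in_gap_pairs[OF assms] in auto)
  with card_image[OF inj_on_fraction_pair[OF assms(1,2)]] show ?thesis by metis
qed

lemma pair_corr_farey_coprime:
  assumes "n > 0" "c > 0" "c \<le> (real n)\<^sup>2"
  shows "pair_corr (farey_coprime m n) {0..<real (card (farey_coprime m n)) * (c / (real n)\<^sup>2)}
       = real (card (neighbour_fractions m n c)) / real (card (farey_coprime m n))"
  unfolding pair_corr_eq
  using assms
    card_close_pairs_eq_gap_pairs[OF finite_farey_coprime farey_coprime_subset, of "c / (real n)\<^sup>2"]
  by (simp add: card_gap_pairs_farey_coprime)

definition farey_corr_density :: "nat \<Rightarrow> real \<Rightarrow> real" where
  "farey_corr_density m x = totient_density m * (C m / x\<^sup>2) *
     (\<Sum>D\<in>nats_between 0 (2 * x / C m). relative_totient m D * ln (2 * x / (C m * real D)))"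

definition farey_corr_distribution :: "nat \<Rightarrow> real \<Rightarrow> real" where
  "farey_corr_distribution m x = 2 * totient_density m *
     (\<Sum>D\<in>nats_between 0 (2 * x / C m).
        hyperbola_area (real D / (2 * x / C m)) * (relative_totient m D / real D))"

lemma has_integral_log_kernel:
  fixes a X :: real
  assumes "0 < a" "a \<le> X"
  shows "((\<lambda>x. if x \<le> a then 0 else ln (x / a) / x\<^sup>2) has_integral hyperbola_area (a / X) / a) {0..X}"
proof -
  define F where "F = (\<lambda>x. - (ln x - ln a + 1) / x)"
  have "((\<lambda>x. if x \<le> a then 0 else ln (x / a) / x\<^sup>2) has_integral (F X - F a)) {0..X}"
  proof (rule has_integral_zero_then_antiderivative)
    fix x assume x_range: "x \<in> {a..X}"
    hence "x > 0" using assms by auto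
    have "(F has_real_derivative (ln x - ln a) / x\<^sup>2) (at x within {a..X})"
      unfolding F_def using \<open>x > 0\<close>
      by (auto intro!: derivative_eq_intros simp: field_simps power2_eq_square)
    also have "(ln x - ln a) / x\<^sup>2 = (if x \<le> a then 0 else ln (x / a) / x\<^sup>2)"
      using x_range assms by (auto simp: ln_div)
    finally show "(F has_real_derivative (if x \<le> a then 0 else ln (x / a) / x\<^sup>2))
        (at x within {a..X})" .
  qed (use assms in auto)
  also have "F X - F a = hyperbola_area (a / X) / a"
    using assms by (auto simp: F_def hyperbola_area_def ln_div field_simps)
  finally show ?thesis .
qed

lemma farey_corr_density_eq_sum:
  assumes "m > 0" "x \<le> X"
  shows "farey_corr_density m x = totient_density m * C m *
     (\<Sum>D\<in>nats_between 0 (2 * X / C m). relative_totient m D *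
        (if x \<le> real D * C m / 2 then 0 else ln (x / (real D * C m / 2)) / x\<^sup>2))"
proof -
  have C_m_pos: "C m > 0" using C_pos[OF assms(1)] .
  let ?t = "\<lambda>D. if x \<le> real D * C m / 2 then 0 else ln (x / (real D * C m / 2)) / x\<^sup>2"
  have "(\<Sum>D\<in>nats_between 0 (2 * X / C m). relative_totient m D * ?t D)
      = (\<Sum>D\<in>nats_between 0 (2 * x / C m). relative_totient m D * (ln (2 * x / (C m * real D)) / x\<^sup>2))"
  proof (rule sum.mono_neutral_cong_right)
    have "2 * x / C m \<le> 2 * X / C m" using assms(2) C_m_pos by (intro divide_right_mono) auto
    thus "nats_between 0 (2 * x / C m) \<subseteq> nats_between 0 (2 * X / C m)"
      by (auto simp: nats_between_def)
    show "\<forall>D\<in>nats_between 0 (2 * X / C m) - nats_between 0 (2 * x / C m).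
        relative_totient m D * ?t D = 0"
      using C_m_pos by (auto simp: nats_between_def field_simps)
    fix D assume D_range: "D \<in> nats_between 0 (2 * x / C m)"
    hence "real D * C m / 2 \<le> x" using C_m_pos by (auto simp: nats_between_def field_simps)
    moreover have "real D * C m / 2 > 0" using D_range C_m_pos by (simp add: nats_between_def)
    moreover have "2 * x / (C m * real D) = x / (real D * C m / 2)" by (simp add: mult.commute)
    ultimately show "relative_totient m D * ?t D
        = relative_totient m D * (ln (2 * x / (C m * real D)) / x\<^sup>2)"
      by auto
  qed simp
  thus ?thesis by (simp add: farey_corr_density_def flip: sum_divide_distrib)
qed

lemma farey_corr_density_has_integral:
  assumes "m > 0"
  shows "(farey_corr_density m has_integral farey_corr_distribution m X) {0..X}"
proof -
  define a where "a D = real D * C m / 2" for D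
  have C_m_pos: "C m > 0" using C_pos[OF assms] .
  have a_bounds: "0 < a D" "a D \<le> X" if "D \<in> nats_between 0 (2 * X / C m)" for D
    using that C_m_pos by (auto simp: a_def nats_between_def field_simps)
  have "((\<lambda>x. totient_density m * C m * (\<Sum>D\<in>nats_between 0 (2 * X / C m). relative_totient m D *
        (if x \<le> a D then 0 else ln (x / a D) / x\<^sup>2)))
      has_integral totient_density m * C m * (\<Sum>D\<in>nats_between 0 (2 * X / C m). relative_totient m D *
        (hyperbola_area (a D / X) / a D))) {0..X}"
    using a_bounds by (intro has_integral_mult_right has_integral_sum has_integral_log_kernel) auto
  also have "totient_density m * C m * (\<Sum>D\<in>nats_between 0 (2 * X / C m). relative_totient m D *
        (hyperbola_area (a D / X) / a D)) = farey_corr_distribution m X"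
    unfolding farey_corr_distribution_def sum_distrib_left
    using C_m_pos by (intro sum.cong refl) (auto simp: a_def mult_ac)
  finally show ?thesis
    unfolding a_def
    by (rule has_integral_eq[rotated]) (simp add: farey_corr_density_eq_sum[OF assms, of _ X])
qed

lemma farey_corr_density_nonneg:
  assumes "m > 0"
  shows "farey_corr_density m x \<ge> 0"
  unfolding farey_corr_density_def using C_pos[OF assms]
  by (intro mult_nonneg_nonneg sum_nonneg ln_ge_zero)
     (auto simp: relative_totient_def totient_density_def nats_between_def field_simps)

lemma isCont_farey_corr_distribution:
  assumes "m > 0" "x > 0"
  shows "isCont (farey_corr_distribution m) x"
proof -
  note has_integral = farey_corr_density_has_integral[OF assms(1)]
  have "continuous_on {0..x + 1} (\<lambda>y. integral {0..y} (farey_corr_density m))"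
    by (rule indefinite_integral_continuous_1[OF has_integral_integrable[OF has_integral]])
  hence "continuous_on {0<..<x + 1} (farey_corr_distribution m)"
    unfolding integral_unique[OF has_integral] by (rule continuous_on_subset) auto
  thus ?thesis using assms by (simp add: continuous_on_eq_continuous_at)
qed

lemma farey_corr_distribution_0: "farey_corr_distribution m 0 = 0"
  by (simp add: farey_corr_distribution_def nats_between_def)

lemma card_neighbour_fractions_asymp:
  assumes "m > 0" "c > 0"
  shows "(\<lambda>n. real (card (neighbour_fractions m n c)) / (real n)\<^sup>2) \<longlonglongrightarrow>
     totient_density m * C m *
       (\<Sum>D\<in>nats_between 0 c. hyperbola_area (real D / c) * (relative_totient m D / real D))"
proof -
  have "(\<lambda>n. \<Sum>D\<in>nats_between 0 c.
        real (card (reduced_det_pairs m n (1 * real n) (real D / c * (real n)\<^sup>2) D)) / (real n)\<^sup>2)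
     \<longlonglongrightarrow> (\<Sum>D\<in>nats_between 0 c. totient_density m * C m * 1 * hyperbola_area (real D / c / 1)
            * (relative_totient m D / real D))"
    using assms by (intro tendsto_sum card_reduced_det_pairs_asymp) (auto simp: nats_between_def)
  thus ?thesis
    by (simp add: card_neighbour_fractions sum_divide_distrib sum_distrib_left mult.assoc)
qed

lemma pair_corr_farey_coprime_scaled_asymp:
  fixes m :: nat and y :: real
  defines "N \<equiv> \<lambda>n. real (card (farey_coprime m n))"
  assumes "m > 0" "y > 0"
  shows "(\<lambda>n. pair_corr (farey_coprime m n) {0..<N n * (2 * y / C m / (real n)\<^sup>2)})
     \<longlonglongrightarrow> farey_corr_distribution m y"
proof -
  define c where "c = 2 * y / C m"
  have C_m_pos: "C m > 0" using C_pos[OF assms(2)] .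
  have c_pos: "c > 0" using assms(3) C_m_pos by (simp add: c_def)
  let ?S = "\<Sum>D\<in>nats_between 0 c. hyperbola_area (real D / c) * (relative_totient m D / real D)"
  have "(\<lambda>n. (real (card (neighbour_fractions m n c)) / (real n)\<^sup>2) / (N n / (real n)\<^sup>2))
     \<longlonglongrightarrow> totient_density m * C m * ?S / (C m / 2)"
    unfolding N_def using C_m_pos c_pos assms(2)
    by (intro tendsto_divide card_neighbour_fractions_asymp card_farey_coprime_asymp) auto
  also have "totient_density m * C m * ?S / (C m / 2) = farey_corr_distribution m y"
    using C_m_pos by (simp add: farey_corr_distribution_def c_def)
  finally have quotient_limit:
    "(\<lambda>n. (real (card (neighbour_fractions m n c)) / (real n)\<^sup>2) / (N n / (real n)\<^sup>2))
       \<longlonglongrightarrow> farey_corr_distribution m y" .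
  have "\<forall>\<^sub>F n in sequentially. c \<le> (real n)\<^sup>2"
    using filterlim_pow_at_top[OF _ filterlim_real_sequentially, of 2]
    by (simp add: filterlim_at_top)
  hence "\<forall>\<^sub>F n in sequentially.
      (real (card (neighbour_fractions m n c)) / (real n)\<^sup>2) / (N n / (real n)\<^sup>2)
        = pair_corr (farey_coprime m n) {0..<N n * (c / (real n)\<^sup>2)}"
    using eventually_gt_at_top[of 0]
  proof eventually_elim
    case (elim n)
    thus ?case unfolding N_def pair_corr_farey_coprime[OF elim(2) c_pos elim(1)] by simp
  qed
  with quotient_limit show ?thesis unfolding c_def by (rule Lim_transform_eventually)
qed

lemma pair_corr_farey_coprime_asymp:
  assumes "m > 0" "x \<ge> 0"
  shows "(\<lambda>n. pair_corr (farey_coprime m n) {0..x}) \<longlonglongrightarrow> farey_corr_distribution m x"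
proof (cases "x = 0")
  case True
  thus ?thesis
    by (simp add: pair_corr_singleton_0[OF farey_coprime_subset] farey_corr_distribution_0)
next
  case False
  define r where "r = (\<lambda>y n. real (card (farey_coprime m n)) * (2 * y / C m / (real n)\<^sup>2))"
  have "(\<lambda>n. 2 * y / C m * (real (card (farey_coprime m n)) / (real n)\<^sup>2))
      \<longlonglongrightarrow> 2 * y / C m * (C m / 2)" for y
    by (intro tendsto_mult_left card_farey_coprime_asymp assms)
  hence r_limit: "r y \<longlonglongrightarrow> y" for y using C_pos[OF assms(1)] by (simp add: r_def mult_ac)
  show ?thesis
  proof (rule tendsto_squeeze_isCont[where a = 0 and x = x and g = "farey_corr_distribution m"
        and p = "\<lambda>y n. pair_corr (farey_coprime m n) {0..<r y n}"])
    show "isCont (farey_corr_distribution m) x"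
      using assms False by (intro isCont_farey_corr_distribution) auto
    show "(\<lambda>n. pair_corr (farey_coprime m n) {0..<r y n}) \<longlonglongrightarrow> farey_corr_distribution m y"
      if "y > 0" for y
      unfolding r_def by (rule pair_corr_farey_coprime_scaled_asymp[OF assms(1) that])
    show "\<forall>\<^sub>F n in sequentially.
        pair_corr (farey_coprime m n) {0..<r y n} \<le> pair_corr (farey_coprime m n) {0..x}"
      if "0 < y" "y < x" for y
      using order_tendstoD(2)[OF r_limit that(2)]
      by eventually_elim (intro pair_corr_mono finite_farey_coprime, auto)
    show "\<forall>\<^sub>F n in sequentially.
        pair_corr (farey_coprime m n) {0..x} \<le> pair_corr (farey_coprime m n) {0..<r y n}"
      if "x < y" for y
      using order_tendstoD(1)[OF r_limit that]
      by eventually_elim (intro pair_corr_mono finite_farey_coprime, auto)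
  qed (use assms False in auto)
qed

lemma asymptotic_content_farey_coprime:
  assumes "m > 0"
  shows "asymptotic_content (\<lambda>n. pair_corr (farey_coprime m n)) (farey_corr_distribution m)"
proof
  show "(farey_corr_distribution m \<longlongrightarrow> farey_corr_distribution m x) (at_left x)" if "x > 0" for x
    using isCont_farey_corr_distribution[OF assms that]
    by (auto simp: isCont_def filterlim_at_split)
  show "pair_corr (farey_coprime m n) I \<ge> 0" for n I by (simp add: pair_corr_def)
qed (intro pair_corr_uminus eventually_pair_corr_Un finite_farey_coprime filterlim_card_farey_coprime
      pair_corr_farey_coprime_asymp farey_corr_distribution_0 assms; assumption)+

lemma pair_correlation_function_farey_coprime:
  assumes "m > 0"
  shows "pair_correlation_function (farey_coprime m) (farey_corr_density m)"
  unfolding pair_correlation_function_def pair_correlation_measure_def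
proof (intro exI[of _ "\<lambda>I. lim (\<lambda>n. pair_corr (farey_coprime m n) I)"] conjI allI impI)
  interpret asymptotic_content "\<lambda>n. pair_corr (farey_coprime m n)" "farey_corr_distribution m"
    by (rule asymptotic_content_farey_coprime[OF assms])
  fix I :: "real set" assume "is_interval I \<and> bounded I"
  thus "(\<lambda>n. pair_corr (farey_coprime m n) I) \<longlonglongrightarrow> lim (\<lambda>n. pair_corr (farey_coprime m n) I)"
    using convergent_bounded_interval by (simp add: convergent_LIMSEQ_iff)
next
  fix x :: real assume x_pos: "x > 0"
  have density_integral: "(farey_corr_density m has_integral farey_corr_distribution m x) {0..x}"
    by (rule farey_corr_density_has_integral[OF assms])
  show "farey_corr_density m absolutely_integrable_on {0..x}"
    using density_integral farey_corr_density_nonneg[OF assms]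
    by (intro nonnegative_absolutely_integrable_1) auto
  show "lim (\<lambda>n. pair_corr (farey_coprime m n) {0..x}) = integral {0..x} (farey_corr_density m)"
    using limI[OF pair_corr_farey_coprime_asymp[OF assms, of x]] x_pos
      integral_unique[OF density_integral] by simp
qed (auto simp: incseq_farey_coprime finite_farey_coprime)

theorem theorem1:
  fixes m :: nat
  assumes "m > 0"
  shows "(\<exists>g. pair_correlation_function (farey_coprime m) g \<and>
            (\<forall>x>0. g x = real (totient m) / real m * (C m / x\<^sup>2) *
               (\<Sum>\<Delta> | 1 \<le> \<Delta> \<and> real \<Delta> \<le> 2 * x / C m.
                  real (totient \<Delta>) * (real (gcd \<Delta> m) / real (totient (gcd \<Delta> m))) *
                  ln (2 * x / (C m * real \<Delta>)))))
       \<and> convergent_prod (\<lambda>p. if prime p \<and> \<not> p dvd m then 1 - 1 / (real p)\<^sup>2 else 1)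
       \<and> C m = real (totient m) / real m *
           (\<Prod>p. if prime p \<and> \<not> p dvd m then 1 - 1 / (real p)\<^sup>2 else 1)"
proof (intro conjI exI[of _ "farey_corr_density m"] allI impI)
  show "pair_correlation_function (farey_coprime m) (farey_corr_density m)"
    by (rule pair_correlation_function_farey_coprime[OF assms])
  have factors: "euler_factor m = (\<lambda>p. if prime p \<and> \<not> p dvd m then 1 - 1 / (real p)\<^sup>2 else 1)"
    by (simp add: euler_factor_def fun_eq_iff)
  show "convergent_prod (\<lambda>p. if prime p \<and> \<not> p dvd m then 1 - 1 / (real p)\<^sup>2 else 1)"
    using convergent_prod_euler_factor[of m] unfolding factors .
  show "C m = real (totient m) / real m *
           (\<Prod>p. if prime p \<and> \<not> p dvd m then 1 - 1 / (real p)\<^sup>2 else 1)"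
    using C_eq_prodinf[OF assms] unfolding factors totient_density_def .
qed (simp add: farey_corr_density_def totient_density_def relative_totient_eq[OF assms]
    nats_between_def Suc_le_eq)

end
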